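(* Let $G$ be a finite simple graph such that the binomial edge ideal $J_G$ is unmixed. Then the set system $\mathcal C(G)$ of cut sets of $G$ is accessible if and only if it is strongly accessible.
   Context: $G$ has vertex set $[n]$; $K$ is a field and $J_G\subset K[x_1,\dots,x_n,y_1,\dots,y_n]$ is generated by $x_iy_j-x_jy_i$ for the edges $\{i,j\}$ of $G$; unmixed means all minimal primes have the same height (equivalently $c_G(S)=|S|+c$ for every cut set $S$, where $c$ is the number of connected components of $G$). For $S\subset[n]$, $c_G(S)$ is the number of connected components of the induced subgraph on $[n]\setminus S$; $S$ is a cut set if $c_G(S)>c_G(S\setminus\{i\})$ for all $i\in S$. A set system $\mathcal C$ is accessible if every nonempty $S\in\mathcal C$ contains $s$ with $S\setminus\{s\}\in\mathcal C$; it is strongly accessible if for all $S,T\in\mathcal C$ with $S\subset T$ there is $v\in T\setminus S$ with $S\cup\{v\}\in\mathcal C$. *)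

theory Defs
  imports
    "HOL-Library.Poly_Mapping"
    "HOL-Library.Extended_Nat"
    "HOL-Algebra.Ideal"
begin

text \<open>A graph is given by its vertex set and its set of two-element edges.\<close>

definition finite_simple_graph :: "'v set \<Rightarrow> 'v set set \<Rightarrow> bool" where
  "finite_simple_graph V E \<longleftrightarrow>
     finite V \<and> (\<forall>e\<in>E. \<exists>i\<in>V. \<exists>j\<in>V. i \<noteq> j \<and> e = {i, j})"

definition induced_adj :: "'v set set \<Rightarrow> 'v set \<Rightarrow> ('v \<times> 'v) set" where
  "induced_adj E W = {(i, j). i \<in> W \<and> j \<in> W \<and> {i, j} \<in> E}"

text \<open>
  The reflexive transitive closure relates all points of the type, but its classes meeting
  \<open>W\<close> lie inside \<open>W\<close>, so this quotient is the set of components of the subgraph induced on \<open>W\<close>.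
\<close>

definition components :: "'v set set \<Rightarrow> 'v set \<Rightarrow> 'v set set" where
  "components E W = W // (induced_adj E W)\<^sup>*"

definition c_comp :: "'v set \<Rightarrow> 'v set set \<Rightarrow> 'v set \<Rightarrow> nat" where
  "c_comp V E S = card (components E (V - S))"

definition cut_sets :: "'v set \<Rightarrow> 'v set set \<Rightarrow> 'v set set" where
  "cut_sets V E = {S. S \<subseteq> V \<and> (\<forall>i\<in>S. c_comp V E S > c_comp V E (S - {i}))}"

definition accessible :: "'v set set \<Rightarrow> bool" where
  "accessible C \<longleftrightarrow> (\<forall>S\<in>C. S \<noteq> {} \<longrightarrow> (\<exists>s\<in>S. S - {s} \<in> C))"

definition strongly_accessible :: "'v set set \<Rightarrow> bool" where
  "strongly_accessible C \<longleftrightarrow> (\<forall>S\<in>C. \<forall>T\<in>C. S \<subset> T \<longrightarrow> (\<exists>v\<in>T - S. insert v S \<in> C))"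

text \<open>
  A polynomial maps monomials (exponent functions of finite support) to coefficients. The
  polynomial ring in a set \<open>I\<close> of indeterminates consists of the polynomials all of whose
  monomials involve only indeterminates from \<open>I\<close>.
\<close>

type_synonym ('x, 'k) mpoly = "('x \<Rightarrow>\<^sub>0 nat) \<Rightarrow>\<^sub>0 'k"

definition indet :: "'x \<Rightarrow> ('x, 'k::comm_ring_1) mpoly" where
  "indet x = Poly_Mapping.single (Poly_Mapping.single x 1) 1"

definition poly_ring :: "'x set \<Rightarrow> ('x, 'k::comm_ring_1) mpoly ring" where
  "poly_ring I =
     \<lparr>carrier = {p. \<forall>m\<in>Poly_Mapping.keys p. Poly_Mapping.keys m \<subseteq> I},
      monoid.mult = (*), one = 1, ring.zero = 0, add = (+)\<rparr>"

lemma cring_poly_ring: "cring (poly_ring I :: ('x, 'k::comm_ring_1) mpoly ring)"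
proof -
  have add: "p + q \<in> carrier (poly_ring I)"
    if "p \<in> carrier (poly_ring I)" "q \<in> carrier (poly_ring I)" for p q :: "('x, 'k) mpoly"
    using that Poly_Mapping.keys_add[of p q] by (auto simp: poly_ring_def)
  have mult: "p * q \<in> carrier (poly_ring I)"
    if "p \<in> carrier (poly_ring I)" "q \<in> carrier (poly_ring I)" for p q :: "('x, 'k) mpoly"
  proof -
    have "Poly_Mapping.keys m \<subseteq> I" if m: "m \<in> Poly_Mapping.keys (p * q)" for m
    proof -
      obtain a b where "m = a + b" "a \<in> Poly_Mapping.keys p" "b \<in> Poly_Mapping.keys q"
        using m keys_mult[of p q] by blast
      then show ?thesis
        using \<open>p \<in> _\<close> \<open>q \<in> _\<close> Poly_Mapping.keys_add[of a b] by (fastforce simp: poly_ring_def)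
    qed
    then show ?thesis by (simp add: poly_ring_def)
  qed
  have inv: "\<exists>q\<in>carrier (poly_ring I). p + q = 0"
    if "p \<in> carrier (poly_ring I)" for p :: "('x, 'k) mpoly"
    using that by (intro bexI[of _ "- p"]) (simp_all add: poly_ring_def)
  have sel [simp]: "mult (poly_ring I) = ((*) :: ('x, 'k) mpoly \<Rightarrow> _)"
    "add (poly_ring I) = ((+) :: ('x, 'k) mpoly \<Rightarrow> _)"
    "one (poly_ring I) = (1 :: ('x, 'k) mpoly)" "zero (poly_ring I) = (0 :: ('x, 'k) mpoly)"
    by (simp_all add: poly_ring_def)
  have zero_one: "0 \<in> carrier (poly_ring I :: ('x, 'k) mpoly ring)"
    "1 \<in> carrier (poly_ring I :: ('x, 'k) mpoly ring)"
    by (simp_all add: poly_ring_def)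
  show ?thesis
    by (intro cringI abelian_groupI comm_monoidI)
      (simp_all add: add mult inv zero_one algebra_simps)
qed

datatype 'v bei_var = X 'v | Y 'v

definition bei_ring :: "'v set \<Rightarrow> ('v bei_var, 'k::field) mpoly ring" where
  "bei_ring V = poly_ring (X ` V \<union> Y ` V)"

text \<open>Both orientations of an edge are included; their generators differ only by a sign.\<close>

definition binomial_edge_ideal ::
    "'v set \<Rightarrow> 'v set set \<Rightarrow> ('v bei_var, 'k::field) mpoly set" where
  "binomial_edge_ideal V E =
     genideal (bei_ring V)
       {indet (X i) * indet (Y j) - indet (X j) * indet (Y i) | i j. {i, j} \<in> E}"

definition minimal_primes :: "('a, 'b) ring_scheme \<Rightarrow> 'a set \<Rightarrow> 'a set set" where
  "minimal_primes R I =
     {P. primeideal P R \<and> I \<subseteq> P \<and>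
         (\<forall>Q. primeideal Q R \<and> I \<subseteq> Q \<and> Q \<subseteq> P \<longrightarrow> Q = P)}"

definition height :: "('a, 'b) ring_scheme \<Rightarrow> 'a set \<Rightarrow> enat" where
  "height R P =
     Sup {enat k | k. \<exists>C :: nat \<Rightarrow> 'a set.
            (\<forall>i\<le>k. primeideal (C i) R) \<and> (\<forall>i<k. C i \<subset> C (Suc i)) \<and> C k = P}"

definition unmixed :: "('a, 'b) ring_scheme \<Rightarrow> 'a set \<Rightarrow> bool" where
  "unmixed R I \<longleftrightarrow>
     (\<forall>P\<in>minimal_primes R I. \<forall>Q\<in>minimal_primes R I. height R P = height R Q)"

end

theory Submission
  imports Defs "HOL-Computational_Algebra.Polynomial"
begin

text \<open>
  For a cut set \<open>S\<close>, the kernel \<open>P\<^sub>S\<close> of the substitution that kills the columns in \<open>S\<close> and makes the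
  remaining columns parallel within each component of \<open>G - S\<close> is a minimal prime of \<open>J\<^sub>G\<close>. Its
  height is \<open>n + |S| - c(S)\<close>: killing variables and merging blocks one at a time gives a chain of
  primes of that length, and longer chains would produce more algebraically independent
  polynomials than there are variables. Hence unmixedness gives \<open>c(S) = |S| + c\<close> for all cut sets.

  It follows that \<open>c(U) \<le> |U| + c\<close> for every set \<open>U\<close> of vertices, with equality exactly for the
  cut sets. If \<open>v\<close> is a cut vertex lying in a cut set \<open>T\<close>, then \<open>v\<close> keeps a neighbour outside \<open>T\<close> in
  every component of \<open>G - v\<close> that it touches, so \<open>U \<union> {v}\<close> is a cut set for every cut set
  \<open>U \<subseteq> T - {v}\<close>. Accessibility of the family of sets attaining equality therefore passes from
  \<open>G\<close> to \<open>G - v\<close>, and deleting the vertices of \<open>S\<close> one by one reduces strong accessibility above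
  \<open>S\<close> to the existence of a cut vertex. (The cut sets of \<open>G - v\<close> themselves need not attain equality.)
\<close>

section \<open>Numbers of components\<close>

abbreviation conn :: "'v set set \<Rightarrow> 'v set \<Rightarrow> 'v \<Rightarrow> 'v \<Rightarrow> bool" where
  "conn E W i j \<equiv> (i, j) \<in> (induced_adj E W)\<^sup>*"

abbreviation ncomp :: "'v set set \<Rightarrow> 'v set \<Rightarrow> nat" where
  "ncomp E W \<equiv> card (components E W)"

lemma equiv_conn: "equiv UNIV ((induced_adj E W)\<^sup>*)"
proof -
  have "sym (induced_adj E W)"
    by (auto simp: sym_def induced_adj_def insert_commute)
  then show ?thesis
    by (intro equivI) (auto simp: refl_rtrancl sym_rtrancl trans_rtrancl)
qed

lemma conn_sym: "conn E W i j \<Longrightarrow> conn E W j i"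
  using equiv_conn[of E W] by (auto simp: equiv_def sym_def)

lemma conn_in: "conn E W i j \<Longrightarrow> i \<in> W \<Longrightarrow> j \<in> W"
  by (induction rule: rtrancl_induct) (auto simp: induced_adj_def)

lemma conn_mono: "A \<subseteq> B \<Longrightarrow> conn E A i j \<Longrightarrow> conn E B i j"
  by (rule rtrancl_mono[THEN subsetD, of "induced_adj E A"]) (auto simp: induced_adj_def)

lemma conn_edge: "i \<in> W \<Longrightarrow> j \<in> W \<Longrightarrow> {i, j} \<in> E \<Longrightarrow> conn E W i j"
  by (auto simp: induced_adj_def)

abbreviation comp_of :: "'v set set \<Rightarrow> 'v set \<Rightarrow> 'v \<Rightarrow> 'v set" where
  "comp_of E W i \<equiv> (induced_adj E W)\<^sup>* `` {i}"

lemma comp_of_eq_iff: "comp_of E W i = comp_of E W j \<longleftrightarrow> conn E W i j"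
  using eq_equiv_class_iff[OF equiv_conn[of E W]] by auto

lemma components_eq: "components E W = comp_of E W ` W"
  by (auto simp: components_def quotient_def)

lemma finite_components [simp]: "finite W \<Longrightarrow> finite (components E W)"
  by (simp add: components_eq)

text \<open>Enlarging the vertex set sends each component into the one that contains it; this map on
  components drives the next three comparisons of counts.\<close>

lemma Image_comp_of: "A \<subseteq> B \<Longrightarrow> (induced_adj E B)\<^sup>* `` comp_of E A x = comp_of E B x"
proof -
  assume AB: "A \<subseteq> B"
  have "conn E B x z" if "conn E A x y" "conn E B y z" for y z
    using conn_mono[OF AB that(1)] that(2) by (rule rtrancl_trans)
  then show ?thesis by blast
qed

text \<open>Every component of the larger graph meets \<open>A\<close>, so the map on components is
  onto.\<close>

lemma ncomp_le:
  assumes "finite A" "A \<subseteq> B" "\<And>x. x \<in> B \<Longrightarrow> \<exists>a\<in>A. conn E B x a"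
  shows "ncomp E B \<le> ncomp E A"
proof (rule surj_card_le)
  show "components E B \<subseteq> (\<lambda>K. (induced_adj E B)\<^sup>* `` K) ` components E A"
  proof
    fix K assume "K \<in> components E B"
    then obtain x where x: "x \<in> B" "K = comp_of E B x" by (auto simp: components_eq)
    then obtain a where "a \<in> A" "conn E B x a" using assms(3) by blast
    then have "K = (induced_adj E B)\<^sup>* `` comp_of E A a"
      using x by (simp only: Image_comp_of[OF assms(2)] comp_of_eq_iff)
    then show "K \<in> (\<lambda>K. (induced_adj E B)\<^sup>* `` K) ` components E A"
      using \<open>a \<in> A\<close> by (auto simp: components_eq)
  qed
qed (simp add: assms)

text \<open>The vertex \<open>v\<close> fuses the components of \<open>a\<close> and
  \<open>b\<close>, so the map on components stays onto after the component of \<open>a\<close> is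
  left out.\<close>

lemma ncomp_insert_less:
  assumes "finite A" "a \<in> A" "b \<in> A" "{v, a} \<in> E" "{v, b} \<in> E" "\<not> conn E A a b"
  shows "ncomp E (insert v A) < ncomp E A"
proof -
  let ?B = "insert v A" and ?F = "\<lambda>K. (induced_adj E (insert v A))\<^sup>* `` K"
  have va: "conn E ?B v a" and vb: "conn E ?B v b"
    using assms by (auto intro!: conn_edge)
  have ab: "comp_of E ?B a = comp_of E ?B b" "comp_of E ?B v = comp_of E ?B b"
    unfolding comp_of_eq_iff using rtrancl_trans[OF conn_sym[OF va] vb] vb by auto
  have b: "comp_of E A b \<in> components E A - {comp_of E A a}"
    using assms comp_of_eq_iff[of E A b a] conn_sym[of b a E A] by (auto simp: components_eq)
  have "components E ?B \<subseteq> ?F ` (components E A - {comp_of E A a})"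
  proof
    fix K assume "K \<in> components E ?B"
    then obtain x where x: "x \<in> ?B" "K = comp_of E ?B x" by (auto simp: components_eq)
    show "K \<in> ?F ` (components E A - {comp_of E A a})"
    proof (cases "x = v \<or> comp_of E A x = comp_of E A a")
      case True
      have "K = ?F (comp_of E A b)"
      proof (cases "x = v")
        case True
        then have "K = comp_of E ?B b" using x ab by simp
        then show ?thesis by (simp only: Image_comp_of[OF subset_insertI])
      next
        case False
        then have "comp_of E A x = comp_of E A a" using True by blast
        then have "comp_of E ?B x = comp_of E ?B a" using Image_comp_of[of A ?B E] by (metis subset_insertI)
        then have "K = comp_of E ?B b" using x ab by simp
        then show ?thesis by (simp only: Image_comp_of[OF subset_insertI])
      qed
      then show ?thesis using b by blast
    next
      case False
      then have "comp_of E A x \<in> components E A - {comp_of E A a}" using x by (auto simp: components_eq)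
      moreover have "K = ?F (comp_of E A x)" using x by (simp only: Image_comp_of[OF subset_insertI])
      ultimately show ?thesis by blast
    qed
  qed
  then have "ncomp E ?B \<le> card (components E A - {comp_of E A a})"
    using assms by (intro surj_card_le) auto
  also have "\<dots> < ncomp E A"
    using assms by (intro psubset_card_mono) (auto simp: components_eq)
  finally show ?thesis .
qed

text \<open>By contraposition: if all neighbours of \<open>v\<close> in \<open>A\<close> are
  connected within \<open>A\<close>, a walk through \<open>v\<close> can be rerouted inside
  \<open>A\<close>, so the map on components is injective.\<close>

lemma ncomp_insert_lessD:
  assumes "finite A" "v \<notin> A" "ncomp E (insert v A) < ncomp E A"
  obtains a b where "a \<in> A" "b \<in> A" "{v, a} \<in> E" "{v, b} \<in> E" "\<not> conn E A a b"
proof (rule ccontr)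
  note found = that
  assume neg: "\<not> thesis"
  have nb: "conn E A a b" if "a \<in> A" "b \<in> A" "{v, a} \<in> E" "{v, b} \<in> E" for a b
    using neg that found by blast
  let ?B = "insert v A" and ?F = "\<lambda>K. (induced_adj E (insert v A))\<^sup>* `` K"
  \<comment> \<open>Invariant along a walk from \<open>x\<close>: while it stands at
    \<open>v\<close>, some neighbour of \<open>v\<close> has already been reached inside
    \<open>A\<close>.\<close>
  have walk: "(y \<noteq> v \<longrightarrow> conn E A x y) \<and> (y = v \<longrightarrow> (\<exists>a\<in>A. {v, a} \<in> E \<and> conn E A x a))"
    if "conn E ?B x y" "x \<in> A" for x y
    using that
  proof (induction rule: rtrancl_induct)
    case base
    then show ?case using assms(2) by auto
  next
    case (step y z)
    then have yz: "y \<in> ?B" "z \<in> ?B" "{y, z} \<in> E" by (auto simp: induced_adj_def)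
    show ?case
    proof (cases "y = v")
      case True
      then obtain a where a: "a \<in> A" "{v, a} \<in> E" "conn E A x a" using step by blast
      then show ?thesis using nb[of a z] yz True by (auto intro: rtrancl_trans)
    next
      case False
      then have "conn E A x y" "y \<in> A" using step yz by auto
      then show ?thesis using yz conn_edge[of y A z E] insert_commute[of y z "{}"]
        by (auto intro: rtrancl_trans)
    qed
  qed
  have "inj_on ?F (components E A)"
  proof (rule inj_onI)
    fix K L assume "K \<in> components E A" "L \<in> components E A" "?F K = ?F L"
    then obtain x y where xy: "x \<in> A" "K = comp_of E A x" "y \<in> A" "L = comp_of E A y"
      by (auto simp: components_eq)
    then have "comp_of E ?B x = comp_of E ?B y"
      using \<open>?F K = ?F L\<close> Image_comp_of[of A ?B E] by blast
    then have "conn E ?B x y" by (simp only: comp_of_eq_iff)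
    then show "K = L" using walk[of x y] xy assms(2) by (simp only: comp_of_eq_iff) blast
  qed
  moreover have "?F ` components E A \<subseteq> components E ?B"
    using Image_comp_of[of A ?B E] by (fastforce simp only: components_eq image_iff image_subset_iff)
  ultimately have "ncomp E A \<le> ncomp E ?B"
    using assms(1) by (intro card_inj_on_le) auto
  then show False using assms(3) by simp
qed

lemma ncomp_Un:
  assumes "finite A" "finite B" "A \<inter> B = {}" "\<And>a b. a \<in> A \<Longrightarrow> b \<in> B \<Longrightarrow> {a, b} \<notin> E"
  shows "ncomp E (A \<union> B) = ncomp E A + ncomp E B"
proof -
  have side: "comp_of E (A \<union> B) x = comp_of E A x"
    if x: "x \<in> A" and nb: "\<And>a b. a \<in> A \<Longrightarrow> b \<in> B \<Longrightarrow> {a, b} \<notin> E" for x A B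
  proof
    show "comp_of E A x \<subseteq> comp_of E (A \<union> B) x" using conn_mono[of A "A \<union> B"] by blast
    have "conn E A x y" if "conn E (A \<union> B) x y" for y
      using that
    proof (induction rule: rtrancl_induct)
      case (step y z)
      then have "y \<in> A" using conn_in x by metis
      moreover have "z \<in> A" using step(2) \<open>y \<in> A\<close> nb by (auto simp: induced_adj_def)
      ultimately have "conn E A y z" using step(2) by (auto simp: induced_adj_def)
      then show ?case using step by (auto intro: rtrancl_trans)
    qed simp
    then show "comp_of E (A \<union> B) x \<subseteq> comp_of E A x" by blast
  qed
  have "comp_of E (A \<union> B) x = comp_of E B x" if "x \<in> B" for x
  proof -
    have "{a, b} \<notin> E" if "a \<in> B" "b \<in> A" for a b using assms(4)[OF that(2,1)] by (simp add: insert_commute)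
    then show ?thesis using side[of x B A] that by (simp add: Un_commute)
  qed
  then have "components E (A \<union> B) = components E A \<union> components E B"
    using side[of _ A B] assms by (auto simp: components_eq image_Un)
  moreover have "components E A \<inter> components E B = {}"
  proof -
    have "False" if "x \<in> A" "y \<in> B" "comp_of E A x = comp_of E B y" for x y
    proof -
      have "conn E B y x" using that(3) by blast
      then show False using conn_in[of y x E B] that assms(3) by blast
    qed
    then show ?thesis by (auto simp: components_eq)
  qed
  ultimately show ?thesis
    using assms by (simp add: card_Un_disjoint)
qed

section \<open>Vertex sets attaining the bound on the number of components\<close>

definition comp_bound :: "'v set \<Rightarrow> 'v set set \<Rightarrow> bool" where
  "comp_bound V E \<longleftrightarrow> finite V \<and> (\<forall>U\<subseteq>V. ncomp E (V - U) \<le> card U + ncomp E V)"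

text \<open>\<open>E\<close> stays fixed when vertices are deleted, since only edges inside the
  current vertex set count. For unmixed graphs this is the family of cut sets, but it also behaves
  well under deletion of a cut vertex.\<close>

definition tight_sets :: "'v set \<Rightarrow> 'v set set \<Rightarrow> 'v set set" where
  "tight_sets V E = {U. U \<subseteq> V \<and> ncomp E (V - U) = card U + ncomp E V}"

text \<open>Deleting from \<open>U\<close> a vertex that violates the cut condition raises \<open>c(U) - |U|\<close>.\<close>

lemma cut_sets_eq_tight_sets:
  assumes fin: "finite V"
    and un: "\<And>S. S \<in> cut_sets V E \<Longrightarrow> c_comp V E S = card S + c_comp V E {}"
  shows "comp_bound V E" "cut_sets V E = tight_sets V E"
proof -
  have *: "ncomp E (V - U) \<le> card U + ncomp E V \<and>
      (ncomp E (V - U) = card U + ncomp E V \<longrightarrow> U \<in> cut_sets V E)" if "U \<subseteq> V" for U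
    using finite_subset[OF that fin] that
  proof (induction U rule: finite_psubset_induct)
    case (psubset U)
    show ?case
    proof (cases "U \<in> cut_sets V E")
      case True
      then show ?thesis using un by (simp add: c_comp_def)
    next
      case False
      then obtain i where i: "i \<in> U" "ncomp E (V - U) \<le> ncomp E (V - (U - {i}))"
        using psubset.prems by (auto simp: cut_sets_def c_comp_def not_less)
      have "ncomp E (V - (U - {i})) \<le> card (U - {i}) + ncomp E V"
        using psubset i by blast
      moreover have "card U = Suc (card (U - {i}))"
        using i psubset.hyps by (metis card_Suc_Diff1)
      ultimately show ?thesis using i(2) by linarith
    qed
  qed
  then show "comp_bound V E" using fin by (simp add: comp_bound_def)
  show "cut_sets V E = tight_sets V E"
  proof (intro equalityI subsetI)
    fix U assume U: "U \<in> cut_sets V E"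
    then show "U \<in> tight_sets V E" using un[OF U] by (auto simp: tight_sets_def cut_sets_def c_comp_def)
  qed (use * in \<open>auto simp: tight_sets_def\<close>)
qed

text \<open>Deleting \<open>i\<close> lowers the bound by one, while \<open>U\<close> attained
  it.\<close>

lemma tight_sets_less:
  assumes "comp_bound V E" "U \<in> tight_sets V E" "i \<in> U"
  shows "ncomp E (V - (U - {i})) < ncomp E (V - U)"
proof -
  have "finite U" "U \<subseteq> V" using assms finite_subset by (auto simp: comp_bound_def tight_sets_def)
  then have "card U = Suc (card (U - {i}))" using assms(3) by (metis card_Suc_Diff1)
  moreover have "ncomp E (V - (U - {i})) \<le> card (U - {i}) + ncomp E V"
    using assms(1) \<open>U \<subseteq> V\<close> unfolding comp_bound_def by blast
  ultimately show ?thesis using assms(2) by (simp add: tight_sets_def)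
qed

text \<open>The count rises by at least one, and the bound leaves room for no more than one.\<close>

lemma insert_tight_set:
  assumes "comp_bound V E" "U \<in> tight_sets V E" "v \<in> V - U"
    "ncomp E (V - U) < ncomp E (V - insert v U)"
  shows "insert v U \<in> tight_sets V E"
proof -
  have U: "U \<subseteq> V" "ncomp E (V - U) = card U + ncomp E V"
    using assms by (auto simp: tight_sets_def)
  have "ncomp E (V - insert v U) \<le> card (insert v U) + ncomp E V"
    using assms U unfolding comp_bound_def by blast
  moreover have "card (insert v U) = Suc (card U)"
    using U assms finite_subset[of U V] by (simp add: comp_bound_def)
  ultimately show ?thesis using U assms by (auto simp: tight_sets_def)
qed

text \<open>
  Were every neighbour of \<open>v\<close> in the component \<open>L\<close> of \<open>a\<close> to lie in \<open>T\<close>, additivity of the number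
  of components would split off \<open>insert v (T \<inter> L)\<close> as a tight set in which \<open>v\<close> joins nothing.
\<close>

lemma neighbour_outside_cut_set:
  assumes b: "comp_bound V E"
    and v: "{v} \<in> tight_sets V E" and T: "T \<in> tight_sets V E" "v \<in> T"
    and a: "a \<in> V - {v}" "{v, a} \<in> E"
  obtains b where "b \<in> V - T" "{v, b} \<in> E" "conn E (V - {v}) a b"
proof (rule ccontr)
  note found = that
  assume neg: "\<not> thesis"
  have fin: "finite V" and le: "\<And>U. U \<subseteq> V \<Longrightarrow> ncomp E (V - U) \<le> card U + ncomp E V"
    using b unfolding comp_bound_def by blast+
  define L where "L = comp_of E (V - {v}) a"
  define M where "M = V - {v} - L"
  have LV: "L \<subseteq> V - {v}" using conn_in[OF _ a(1)] by (auto simp: L_def)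
  have nbT: "b \<in> T" if "b \<in> L" "{v, b} \<in> E" for b
  proof (rule ccontr)
    assume "b \<notin> T"
    then have "b \<in> V - T" "conn E (V - {v}) a b" using that LV by (auto simp: L_def)
    then show False using neg found that by blast
  qed
  have vV: "v \<in> V" and TV: "T \<subseteq> V" using v T by (auto simp: tight_sets_def)
  have nLM: "{x, y} \<notin> E" if "x \<in> L" "y \<in> M" for x y
  proof
    assume "{x, y} \<in> E"
    then have "conn E (V - {v}) x y" using that LV by (intro conn_edge) (auto simp: M_def)
    then have "y \<in> L" using that by (auto simp: L_def)
    then show False using that by (simp add: M_def)
  qed
  have add: "ncomp E (L' \<union> M') = ncomp E L' + ncomp E M'" if "L' \<subseteq> L" "M' \<subseteq> M" for L' M'
  proof (rule ncomp_Un)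
    have "L' \<subseteq> V" "M' \<subseteq> V" using that LV by (auto simp: M_def)
    then show "finite L'" "finite M'" by (simp_all add: finite_subset[OF _ fin])
    show "L' \<inter> M' = {}" using that by (auto simp: M_def)
  qed (use that nLM in blast)
  \<comment> \<open>Facts 1 and 2 are the tightness of \<open>{v}\<close> and of \<open>T\<close>,
    split over \<open>L\<close> and \<open>M\<close>; 3 is the bound for
    \<open>insert v (T \<inter> M)\<close>. Adding 1 and 2 and subtracting 3 shows, by 4, that
    \<open>insert v (T \<inter> L)\<close> attains the bound.\<close>
  have 1: "ncomp E L + ncomp E M = 1 + ncomp E V"
  proof -
    have "L \<union> M = V - {v}" using LV by (auto simp: M_def)
    then show ?thesis using add[of L M] v by (simp add: tight_sets_def)
  qed
  have 2: "ncomp E (L - T) + ncomp E (M - T) = card T + ncomp E V"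
  proof -
    have "(L - T) \<union> (M - T) = V - T" using LV T by (auto simp: M_def)
    then show ?thesis using add[of "L - T" "M - T"] T by (auto simp: tight_sets_def)
  qed
  have finT: "finite T" using TV fin finite_subset by blast
  have 3: "ncomp E L + ncomp E (M - T) \<le> card (T \<inter> M) + 1 + ncomp E V"
  proof -
    have "L \<union> (M - T) = V - insert v (T \<inter> M)" using LV by (auto simp: M_def)
    moreover have "card (insert v (T \<inter> M)) = Suc (card (T \<inter> M))" using finT by (simp add: M_def)
    ultimately show ?thesis
      using add[of L "M - T"] le[of "insert v (T \<inter> M)"] vV TV by auto
  qed
  have 4: "card T = 1 + card (T \<inter> L) + card (T \<inter> M)"
  proof -
    have "T = insert v (T \<inter> L \<union> T \<inter> M)" using TV T LV by (auto simp: M_def)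
    then have "card T = card (insert v (T \<inter> L \<union> T \<inter> M))" by simp
    also have "\<dots> = 1 + card (T \<inter> L \<union> T \<inter> M)" using finT LV by (subst card_insert_disjoint) (auto simp: M_def)
    also have "card (T \<inter> L \<union> T \<inter> M) = card (T \<inter> L) + card (T \<inter> M)"
      using finT by (intro card_Un_disjoint) (auto simp: M_def)
    finally show ?thesis by simp
  qed
  let ?U = "insert v (T \<inter> L)"
  have VU: "V - ?U = (L - T) \<union> M" using LV by (auto simp: M_def)
  have cU: "ncomp E (V - ?U) = ncomp E (L - T) + ncomp E M"
    unfolding VU by (intro add) auto
  have cardU: "card ?U = Suc (card (T \<inter> L))" using finT LV by (subst card_insert_disjoint) auto
  have "ncomp E (V - ?U) = card ?U + ncomp E V"
  proof (rule antisym)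
    show "ncomp E (V - ?U) \<le> card ?U + ncomp E V" using le[of ?U] vV TV by auto
    show "card ?U + ncomp E V \<le> ncomp E (V - ?U)" using 1 2 3 4 cU cardU by linarith
  qed
  then have "?U \<in> tight_sets V E" using vV TV by (auto simp: tight_sets_def)
  \<comment> \<open>By tightness, restoring \<open>v\<close> must lower the count. Since no
    neighbour of \<open>v\<close> lies in \<open>L - T\<close>, the drop takes place within
    \<open>M\<close>.\<close>
  then have "ncomp E (V - (?U - {v})) < ncomp E (V - ?U)" by (intro tight_sets_less[OF b]) auto
  also have "V - (?U - {v}) = (L - T) \<union> insert v M" using LV vV by (auto simp: M_def)
  also have "ncomp E \<dots> = ncomp E (L - T) + ncomp E (insert v M)"
  proof (rule ncomp_Un)
    have "L - T \<subseteq> V" "insert v M \<subseteq> V" using vV LV by (auto simp: M_def)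
    then show "finite (L - T)" "finite (insert v M)" by (simp_all add: finite_subset[OF _ fin])
    show "(L - T) \<inter> insert v M = {}" using LV by (auto simp: M_def)
    fix x y assume "x \<in> L - T" "y \<in> insert v M"
    then show "{x, y} \<notin> E" using nLM[of x y] nbT[of x] by (cases "y = v") (auto simp: insert_commute)
  qed
  finally have 5: "ncomp E (insert v M) < ncomp E M" using cU by simp
  \<comment> \<open>Every vertex of \<open>L\<close> reaches \<open>v\<close> through
    \<open>a\<close>, so each component of the whole graph meets \<open>insert v M\<close>. As
    \<open>L\<close> is connected, 1 gives \<open>M\<close> exactly \<open>ncomp E V\<close>
    components, which contradicts 5.\<close>
  have "ncomp E V \<le> ncomp E (insert v M)"
  proof (rule ncomp_le)
    fix x assume "x \<in> V"
    show "\<exists>y\<in>insert v M. conn E V x y"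
    proof (cases "x \<in> insert v M")
      case False
      then have "conn E (V - {v}) a x" using \<open>x \<in> V\<close> by (auto simp: M_def L_def)
      then have "conn E V x a" using conn_sym[OF conn_mono[of "V - {v}" V a x E]] by blast
      moreover have "conn E V a v"
        using a vV by (intro conn_edge) (auto simp: insert_commute)
      ultimately show ?thesis by (auto intro: rtrancl_trans)
    qed auto
  qed (use fin vV in \<open>auto simp: M_def\<close>)
  moreover have "ncomp E L = 1"
  proof -
    have "comp_of E L x = L" if "x \<in> L" for x
    proof
      show "comp_of E L x \<subseteq> L" using conn_in[OF _ that] by auto
      have sub: "conn E L a y" if "conn E (V - {v}) a y" for y
        using that
      proof (induction rule: rtrancl_induct)
        case (step y z)
        then have "y \<in> L" "z \<in> L" by (auto simp: L_def intro: rtrancl_into_rtrancl)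
        then have "conn E L y z" using step(2) by (auto simp: induced_adj_def)
        then show ?case using step by (auto intro: rtrancl_trans)
      qed simp
      then have "conn E L x y" if "y \<in> L" for y
        using rtrancl_trans[OF conn_sym[OF sub] sub] \<open>x \<in> L\<close> that by (simp add: L_def)
      then show "L \<subseteq> comp_of E L x" by blast
    qed
    then have "components E L = {L}" using a by (auto simp: components_eq L_def)
    then show ?thesis by simp
  qed
  ultimately show False using 1 5 by simp
qed

text \<open>Two neighbours of \<open>v\<close> in different components of \<open>G - v\<close> can
  be traded, by the previous lemma, for neighbours outside \<open>T\<close>. These survive the
  deletion of \<open>U\<close> and stay separated, so \<open>v\<close> still joins two
  components.\<close>

lemma insert_cut_vertex:
  assumes b: "comp_bound V E"
    and v: "{v} \<in> tight_sets V E" and T: "T \<in> tight_sets V E" "v \<in> T"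
    and U: "U \<in> tight_sets V E" "U \<subseteq> T - {v}"
  shows "insert v U \<in> tight_sets V E"
proof (rule insert_tight_set[OF b U(1)])
  have fin: "finite V" using b by (simp add: comp_bound_def)
  have vV: "v \<in> V" and TV: "T \<subseteq> V" using v T by (auto simp: tight_sets_def)
  show "v \<in> V - U" using vV U by auto
  have "ncomp E (V - ({v} - {v})) < ncomp E (V - {v})"
    by (intro tight_sets_less[OF b v]) simp
  then have "ncomp E (insert v (V - {v})) < ncomp E (V - {v})"
    using vV by (simp add: insert_absorb)
  then obtain a b where ab: "a \<in> V - {v}" "b \<in> V - {v}" "{v, a} \<in> E" "{v, b} \<in> E"
    "\<not> conn E (V - {v}) a b"
    using fin by (elim ncomp_insert_lessD[rotated 2]) auto
  obtain a' where a': "a' \<in> V - T" "{v, a'} \<in> E" "conn E (V - {v}) a a'"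
    using neighbour_outside_cut_set[OF b v T ab(1,3)] .
  obtain b' where b': "b' \<in> V - T" "{v, b'} \<in> E" "conn E (V - {v}) b b'"
    using neighbour_outside_cut_set[OF b v T ab(2,4)] .
  have "\<not> conn E (V - {v}) a' b'"
    using ab(5) a'(3) b'(3) conn_sym by (metis rtrancl_trans)
  then have "\<not> conn E (V - insert v U) a' b'"
    using conn_mono[of "V - insert v U" "V - {v}"] by blast
  then have "ncomp E (insert v (V - insert v U)) < ncomp E (V - insert v U)"
    using a' b' fin U T by (intro ncomp_insert_less[of _ a' b']) auto
  moreover have "insert v (V - insert v U) = V - U" using vV U by auto
  ultimately show "ncomp E (V - U) < ncomp E (V - insert v U)" by simp
qed

text \<open>Since \<open>G - v\<close> has one component more than \<open>G\<close>, the set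
  \<open>U\<close> in \<open>G - v\<close> is as far from its bound as \<open>insert v U\<close> is
  in \<open>G\<close>.\<close>

lemma tight_sets_delete_vertex:
  assumes "comp_bound V E" "{v} \<in> tight_sets V E"
  shows "comp_bound (V - {v}) E"
    and "tight_sets (V - {v}) E = {U. v \<notin> U \<and> insert v U \<in> tight_sets V E}"
proof -
  have c1: "ncomp E (V - {v}) = 1 + ncomp E V" and vV: "v \<in> V" and fin: "finite V"
    using assms by (auto simp: tight_sets_def comp_bound_def)
  have eq: "V - {v} - U = V - insert v U" for U by auto
  have card: "card (insert v U) = Suc (card U)" if "U \<subseteq> V - {v}" for U
    using that fin finite_subset[of U "V - {v}"] by (subst card_insert_disjoint) auto
  show "comp_bound (V - {v}) E"
    unfolding comp_bound_def
  proof (intro conjI allI impI)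
    fix U assume "U \<subseteq> V - {v}"
    moreover from this have "insert v U \<subseteq> V" using vV by auto
    ultimately show "ncomp E (V - {v} - U) \<le> card U + ncomp E (V - {v})"
      using assms(1) c1 card[of U] unfolding eq comp_bound_def
      by (metis add_Suc_shift plus_1_eq_Suc)
  qed (use fin in simp)
  have "U \<in> tight_sets (V - {v}) E \<longleftrightarrow> v \<notin> U \<and> insert v U \<in> tight_sets V E" for U
  proof (cases "U \<subseteq> V - {v}")
    case True
    then show ?thesis
      using card[OF True] c1 vV unfolding tight_sets_def eq by auto
  qed (auto simp: tight_sets_def)
  then show "tight_sets (V - {v}) E = {U. v \<notin> U \<and> insert v U \<in> tight_sets V E}" by blast
qed

section \<open>Accessible and strongly accessible families of tight sets\<close>

lemma accessible_singleton:
  assumes "finite T" "accessible C" "T \<in> C" "T \<noteq> {}"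
  obtains v where "v \<in> T" "{v} \<in> C"
proof -
  have "\<exists>v\<in>T. {v} \<in> C"
    using assms(1,3,4)
  proof (induction T rule: finite_psubset_induct)
    case (psubset T)
    then obtain s where s: "s \<in> T" "T - {s} \<in> C" using assms(2) unfolding accessible_def by blast
    show ?case
    proof (cases "T - {s} = {}")
      case True
      then have "T = {s}" using s by blast
      then show ?thesis using psubset.prems by simp
    next
      case False
      then show ?thesis using psubset.IH[of "T - {s}"] s by blast
    qed
  qed
  then show thesis using that by blast
qed

text \<open>If accessibility removes from \<open>insert v U\<close> some \<open>t\<close> other than
  \<open>v\<close>, that \<open>t\<close> serves. If it removes \<open>v\<close>, accessibility is
  applied once more to \<open>U\<close>, and \<open>insert_cut_vertex\<close> puts \<open>v\<close>
  back.\<close>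

lemma accessible_tight_sets_delete_vertex:
  assumes b: "comp_bound V E" and acc: "accessible (tight_sets V E)" and v: "{v} \<in> tight_sets V E"
  shows "accessible (tight_sets (V - {v}) E)"
  unfolding accessible_def tight_sets_delete_vertex(2)[OF b v]
proof (intro ballI impI)
  fix U assume "U \<in> {U. v \<notin> U \<and> insert v U \<in> tight_sets V E}" and ne: "U \<noteq> {}"
  then have U: "v \<notin> U" "insert v U \<in> tight_sets V E" by auto
  then obtain t where t: "t \<in> insert v U" "insert v U - {t} \<in> tight_sets V E"
    using acc unfolding accessible_def by (metis insert_not_empty)
  show "\<exists>s\<in>U. U - {s} \<in> {U. v \<notin> U \<and> insert v U \<in> tight_sets V E}"
  proof (cases "t = v")
    case True
    then have "U \<in> tight_sets V E" using t U by simp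
    then obtain s where s: "s \<in> U" "U - {s} \<in> tight_sets V E"
      using acc ne unfolding accessible_def by blast
    have "insert v (U - {s}) \<in> tight_sets V E"
      using U s by (intro insert_cut_vertex[OF b v U(2)]) auto
    then show ?thesis using s U by blast
  next
    case False
    then have "insert v U - {t} = insert v (U - {t})" by auto
    then show ?thesis using t False U by auto
  qed
qed

text \<open>Induction on \<open>S\<close> with varying graph: a cut vertex \<open>s\<close> in
  \<open>S\<close> is deleted from the graph and from both sets. At \<open>S = {}\<close> a tight
  singleton inside \<open>T\<close> gives the vertex.\<close>

lemma accessible_imp_strongly_accessible:
  assumes "comp_bound V E" "accessible (tight_sets V E)"
  shows "strongly_accessible (tight_sets V E)"
proof -
  have "\<exists>v\<in>T - S. insert v S \<in> tight_sets V E"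
    if "finite S" "comp_bound V E" "accessible (tight_sets V E)"
      "S \<in> tight_sets V E" "T \<in> tight_sets V E" "S \<subset> T" for S T V
    using that
  proof (induction S arbitrary: T V rule: finite_psubset_induct)
    case (psubset S)
    note b = \<open>comp_bound V E\<close> and acc = \<open>accessible (tight_sets V E)\<close>
    show ?case
    proof (cases "S = {}")
      case True
      have "finite T" using b psubset.prems finite_subset by (auto simp: comp_bound_def tight_sets_def)
      then obtain v where "v \<in> T" "{v} \<in> tight_sets V E"
        using accessible_singleton[OF _ acc] psubset.prems by blast
      then show ?thesis using True by auto
    next
      case False
      then obtain s where s: "s \<in> S" "{s} \<in> tight_sets V E"
        using accessible_singleton[OF _ acc] psubset by blast
      note del = tight_sets_delete_vertex[OF b s(2)]
      have "\<exists>v\<in>(T - {s}) - (S - {s}). insert v (S - {s}) \<in> tight_sets (V - {s}) E"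
      proof (rule psubset.IH)
        show "S - {s} \<subset> S" "S - {s} \<subset> T - {s}" using s psubset.prems by auto
        show "S - {s} \<in> tight_sets (V - {s}) E" "T - {s} \<in> tight_sets (V - {s}) E"
          unfolding del(2) using s psubset.prems by (auto simp: insert_absorb)
      qed (use del(1) accessible_tight_sets_delete_vertex[OF b acc s(2)] in auto)
      then obtain v where "v \<in> T - S" "insert s (insert v (S - {s})) \<in> tight_sets V E"
        unfolding del(2) by auto
      moreover have "insert s (insert v (S - {s})) = insert v S" using s by auto
      ultimately show ?thesis by auto
    qed
  qed
  moreover have "finite S" if "S \<in> tight_sets V E" for S
    using that assms(1) finite_subset by (auto simp: comp_bound_def tight_sets_def)
  ultimately show ?thesis
    using assms unfolding strongly_accessible_def by blast
qed

text \<open>Climb from \<open>{}\<close> to \<open>T\<close> one element at a time; the element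
  added last is the one to remove.\<close>

lemma strongly_accessible_imp_accessible:
  assumes "\<And>T. T \<in> C \<Longrightarrow> finite T" "{} \<in> C" "strongly_accessible C"
  shows "accessible C"
  unfolding accessible_def
proof (intro ballI impI)
  fix T assume T: "T \<in> C" "T \<noteq> {}"
  have "\<exists>s\<in>T. T - {s} \<in> C" if "S \<in> C" "S \<subset> T" for S
    using that
  proof (induction "card (T - S)" arbitrary: S rule: less_induct)
    case less
    then obtain v where v: "v \<in> T - S" "insert v S \<in> C"
      using assms(3) T unfolding strongly_accessible_def by blast
    show ?case
    proof (cases "insert v S = T")
      case True
      then have "T - {v} = S" using v by auto
      then show ?thesis using v less.prems by auto
    next
      case False
      then have "insert v S \<subset> T" using v less.prems by auto
      moreover have "card (T - insert v S) < card (T - S)"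
        using assms(1)[OF T(1)] v by (intro psubset_card_mono) auto
      ultimately show ?thesis using less.hyps v by blast
    qed
  qed
  then show "\<exists>s\<in>T. T - {s} \<in> C" using assms(2) T by blast
qed

lemma accessible_iff_strongly_accessible_cut_sets:
  assumes "finite V"
    and "\<And>S. S \<in> cut_sets V E \<Longrightarrow> c_comp V E S = card S + c_comp V E {}"
  shows "accessible (cut_sets V E) \<longleftrightarrow> strongly_accessible (cut_sets V E)"
  using cut_sets_eq_tight_sets[OF assms] accessible_imp_strongly_accessible[of V E]
    strongly_accessible_imp_accessible[of "tight_sets V E"] finite_subset[OF _ assms(1)]
  by (auto simp: tight_sets_def)

section \<open>Substitution in polynomials\<close>

lemma poly_ring_sel [simp]:
  "monoid.mult (poly_ring I) = (*)" "ring.add (poly_ring I) = (+)"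
  "monoid.one (poly_ring I) = 1" "ring.zero (poly_ring I) = 0"
  by (simp_all add: poly_ring_def)

abbreviation polys :: "'x set \<Rightarrow> ('x, 'k::comm_ring_1) mpoly set" where
  "polys I \<equiv> carrier (poly_ring I)"

abbreviation const :: "'k \<Rightarrow> ('x, 'k::comm_ring_1) mpoly" where
  "const c \<equiv> Poly_Mapping.single 0 c"

lemma polys_iff: "p \<in> polys I \<longleftrightarrow> (\<forall>m\<in>Poly_Mapping.keys p. Poly_Mapping.keys m \<subseteq> I)"
  by (simp add: poly_ring_def)

lemma polys_UNIV [simp]: "polys UNIV = UNIV"
  by (auto simp: poly_ring_def)

lemma polys_mono: "I \<subseteq> J \<Longrightarrow> polys I \<subseteq> polys J"
  by (fastforce simp: polys_iff)

lemma polys_0 [simp]: "0 \<in> polys I" and polys_1 [simp]: "1 \<in> polys I"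
  by (simp_all add: polys_iff)

lemma polys_const [simp]: "const c \<in> polys I"
  by (simp add: polys_iff)

lemma polys_indet [simp]: "x \<in> I \<Longrightarrow> indet x \<in> polys I"
  by (simp add: polys_iff indet_def)

lemma polys_add [simp]: "p \<in> polys I \<Longrightarrow> q \<in> polys I \<Longrightarrow> p + q \<in> polys I"
  and polys_mult [simp]: "p \<in> polys I \<Longrightarrow> q \<in> polys I \<Longrightarrow> p * q \<in> polys I"
  and polys_uminus [simp]: "p \<in> polys I \<Longrightarrow> - p \<in> polys I"
proof -
  interpret cring "poly_ring I :: ('a, 'b) mpoly ring" by (rule cring_poly_ring)
  show "p + q \<in> polys I" "p * q \<in> polys I" if "p \<in> polys I" "q \<in> polys I"
    using a_closed[OF that] m_closed[OF that] by simp_all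
  show "- p \<in> polys I" if "p \<in> polys I"
    using that by (simp add: poly_ring_def)
qed

lemma polys_diff [simp]: "p \<in> polys I \<Longrightarrow> q \<in> polys I \<Longrightarrow> p - q \<in> polys I"
  using polys_add[of p I "- q"] by simp

lemma polys_power [simp]: "p \<in> polys I \<Longrightarrow> p ^ n \<in> polys I"
  by (induction n) auto

lemma polys_sum: "(\<And>i. i \<in> A \<Longrightarrow> f i \<in> polys I) \<Longrightarrow> sum f A \<in> polys I"
  by (induction A rule: infinite_finite_induct) auto

lemma poly_mapping_expand:
  "p = (\<Sum>m\<in>Poly_Mapping.keys p. Poly_Mapping.single m (Poly_Mapping.lookup p m))"
  by (rule poly_mapping_eqI)
    (auto simp: lookup_sum lookup_single when_def in_keys_iff)

lemma indet_power: "indet x ^ k = Poly_Mapping.single (Poly_Mapping.single x k) 1"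
  by (induction k) (simp_all add: indet_def mult_single single_add[symmetric])

lemma single_sum_exponents:
  "Poly_Mapping.single (sum h A) (1::'k::comm_ring_1) = (\<Prod>x\<in>A. Poly_Mapping.single (h x) 1)"
proof (induction A rule: infinite_finite_induct)
  case (insert x A)
  then show ?case by (simp add: insert.IH[symmetric] mult_single)
qed simp_all

lemma single_eq_prod_indet:
  "Poly_Mapping.single m (1::'k::comm_ring_1) =
    (\<Prod>x\<in>Poly_Mapping.keys m. indet x ^ Poly_Mapping.lookup m x)"
  by (subst poly_mapping_expand[of m]) (simp add: single_sum_exponents indet_power)

text \<open>Identities between substitutions reduce through this rule to constants and
  indeterminates. The membership premises of the last two cases give access to the closure of
  \<open>polys I\<close>.\<close>

lemma polys_induct [consumes 1, case_names const indet add mult]: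
  assumes "p \<in> polys I"
    and const: "\<And>c. P (const c)" and indet: "\<And>x. x \<in> I \<Longrightarrow> P (indet x)"
    and add: "\<And>p q. p \<in> polys I \<Longrightarrow> q \<in> polys I \<Longrightarrow> P p \<Longrightarrow> P q \<Longrightarrow> P (p + q)"
    and mult: "\<And>p q. p \<in> polys I \<Longrightarrow> q \<in> polys I \<Longrightarrow> P p \<Longrightarrow> P q \<Longrightarrow> P (p * q)"
  shows "P p"
proof -
  have P01: "P 0" "P 1" using const[of 0] const[of 1] by simp_all
  have pow: "P (indet x ^ k)" if "x \<in> I" for x k
    by (induction k) (use that P01 in \<open>auto intro!: mult indet\<close>)
  have prod: "P (prod f A) \<and> prod f A \<in> polys I" if "\<And>i. i \<in> A \<Longrightarrow> P (f i) \<and> f i \<in> polys I"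
    for A :: "'a set" and f
    using that by (induction A rule: infinite_finite_induct) (auto intro!: mult P01)
  have monom: "P (Poly_Mapping.single m c)" if "Poly_Mapping.keys m \<subseteq> I" for m c
  proof -
    have "Poly_Mapping.single m c = const c * Poly_Mapping.single m 1" by (simp add: mult_single)
    moreover have "P (Poly_Mapping.single m 1) \<and> Poly_Mapping.single m (1::'b) \<in> polys I"
      unfolding single_eq_prod_indet using that by (intro prod) (auto intro: pow)
    ultimately show ?thesis using mult[OF polys_const _ const] by simp
  qed
  have "P (sum f A) \<and> sum f A \<in> polys I" if "\<And>i. i \<in> A \<Longrightarrow> P (f i) \<and> f i \<in> polys I"
    for A :: "('a \<Rightarrow>\<^sub>0 nat) set" and f
    using that by (induction A rule: infinite_finite_induct) (auto intro!: add P01)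
  then show ?thesis
    using assms(1) monom by (subst poly_mapping_expand) (force simp: polys_iff)
qed

definition monom_subst :: "('x \<Rightarrow> 'b::comm_ring_1) \<Rightarrow> ('x \<Rightarrow>\<^sub>0 nat) \<Rightarrow> 'b" where
  "monom_subst f m = (\<Prod>x\<in>Poly_Mapping.keys m. f x ^ Poly_Mapping.lookup m x)"

definition psubst :: "('x \<Rightarrow> ('y, 'k) mpoly) \<Rightarrow> ('x, 'k::comm_ring_1) mpoly \<Rightarrow> ('y, 'k) mpoly" where
  "psubst f p = (\<Sum>m\<in>Poly_Mapping.keys p. const (Poly_Mapping.lookup p m) * monom_subst f m)"

text \<open>Padding with zero exponents lets two monomials share one index set;
  \<open>psubst_superset\<close> does the same for the monomials of two polynomials.\<close>

lemma monom_subst_superset: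
  assumes "finite A" "Poly_Mapping.keys m \<subseteq> A"
  shows "monom_subst f m = (\<Prod>x\<in>A. f x ^ Poly_Mapping.lookup m x)"
  unfolding monom_subst_def using assms
  by (intro prod.mono_neutral_left) (auto simp: in_keys_iff)

lemma monom_subst_add: "monom_subst f (m + n) = monom_subst f m * monom_subst f n"
proof -
  let ?A = "Poly_Mapping.keys m \<union> Poly_Mapping.keys n"
  have "Poly_Mapping.keys (m + n) \<subseteq> ?A" by (rule Poly_Mapping.keys_add)
  then show ?thesis
    by (simp add: monom_subst_superset[of ?A] lookup_add power_add prod.distrib)
qed

lemma psubst_superset:
  assumes "finite A" "Poly_Mapping.keys p \<subseteq> A"
  shows "psubst f p = (\<Sum>m\<in>A. const (Poly_Mapping.lookup p m) * monom_subst f m)"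
  unfolding psubst_def using assms
  by (intro sum.mono_neutral_left) (auto simp: in_keys_iff)

lemma psubst_add [simp]: "psubst f (p + q) = psubst f p + psubst f q"
proof -
  let ?A = "Poly_Mapping.keys p \<union> Poly_Mapping.keys q"
  have "Poly_Mapping.keys (p + q) \<subseteq> ?A" by (rule Poly_Mapping.keys_add)
  then show ?thesis
    by (simp add: psubst_superset[of ?A] lookup_add single_add distrib_right sum.distrib)
qed

lemma psubst_single: "psubst f (Poly_Mapping.single m c) = const c * monom_subst f m"
  by (subst psubst_superset[of "{m}"]) auto

lemma psubst_0 [simp]: "psubst f 0 = 0"
  by (simp add: psubst_def)

lemma psubst_const [simp]: "psubst f (const c) = const c"
  by (simp add: psubst_single monom_subst_def)

lemma psubst_1 [simp]: "psubst f 1 = 1"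
  using psubst_const[of f 1] by simp

lemma psubst_indet [simp]: "psubst f (indet x) = f x"
  by (simp add: indet_def psubst_single monom_subst_def)

lemma psubst_sum: "psubst f (sum g A) = (\<Sum>i\<in>A. psubst f (g i))"
  by (induction A rule: infinite_finite_induct) auto

lemma psubst_uminus [simp]: "psubst f (- p) = - psubst f p"
  using psubst_add[of f p "- p"] by (simp add: eq_neg_iff_add_eq_0 add.commute)

lemma psubst_diff [simp]: "psubst f (p - q) = psubst f p - psubst f q"
  using psubst_add[of f p "- q"] by simp

lemma psubst_mult [simp]: "psubst f (p * q) = psubst f p * psubst f q"
proof -
  let ?c = Poly_Mapping.lookup and ?s = Poly_Mapping.single
  have "p * q = (\<Sum>m\<in>Poly_Mapping.keys p. \<Sum>n\<in>Poly_Mapping.keys q. ?s (m + n) (?c p m * ?c q n))"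
    by (subst poly_mapping_expand[of p], subst poly_mapping_expand[of q])
      (simp add: sum_product mult_single)
  also have "psubst f \<dots> = (\<Sum>m\<in>Poly_Mapping.keys p. \<Sum>n\<in>Poly_Mapping.keys q.
      (const (?c p m) * monom_subst f m) * (const (?c q n) * monom_subst f n))"
    by (simp add: psubst_sum psubst_single monom_subst_add mult_single[of 0 _ 0, simplified, symmetric] mult_ac)
  also have "\<dots> = psubst f p * psubst f q" by (simp add: psubst_def sum_product)
  finally show ?thesis .
qed

lemma psubst_psubst: "psubst g (psubst f p) = psubst (\<lambda>x. psubst g (f x)) p"
proof -
  have "p \<in> polys UNIV" by simp
  then show ?thesis by (induction p rule: polys_induct) auto
qed

lemma psubst_cong:
  assumes "p \<in> polys I" "\<And>x. x \<in> I \<Longrightarrow> f x = g x"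
  shows "psubst f p = psubst g p"
  using assms by (induction p rule: polys_induct) auto

lemma psubst_id [simp]: "psubst indet p = p"
proof -
  have "p \<in> polys UNIV" by simp
  then show ?thesis by (induction p rule: polys_induct) auto
qed

lemma psubst_in_polys:
  assumes "p \<in> polys I" "\<And>x. x \<in> I \<Longrightarrow> f x \<in> polys J"
  shows "psubst f p \<in> polys J"
  using assms by (induction p rule: polys_induct) auto

lemma finite_vars: "\<exists>J. finite J \<and> p \<in> polys J"
  by (rule exI[of _ "\<Union>m\<in>Poly_Mapping.keys p. Poly_Mapping.keys m"]) (auto simp: polys_iff)

text \<open>
  The library's instance needs linearly ordered indeterminates; finitely many of any kind can
  be renamed to natural numbers.
\<close>

lemma mpoly_mult_eq_0D:
  fixes p q :: "('x, 'k::idom) mpoly"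
  assumes "p * q = 0"
  shows "p = 0 \<or> q = 0"
proof -
  obtain J where J: "finite J" "p \<in> polys J" "q \<in> polys J"
  proof -
    obtain J1 J2 where "finite J1" "p \<in> polys J1" "finite J2" "q \<in> polys J2"
      using finite_vars[of p] finite_vars[of q] by blast
    then show ?thesis
      using polys_mono[of J1 "J1 \<union> J2"] polys_mono[of J2 "J1 \<union> J2"]
      by (intro that[of "J1 \<union> J2"]) auto
  qed
  obtain e :: "'x \<Rightarrow> nat" where e: "inj_on e J"
    using finite_imp_inj_to_nat_seg[OF J(1)] by blast
  let ?to = "psubst (\<lambda>x. indet (e x))" and ?from = "psubst (\<lambda>y. indet (inv_into J e y))"
  have undo: "?from (?to r) = r" if "r \<in> polys J" for r :: "('x, 'k) mpoly"
    using psubst_cong[OF that, of "\<lambda>x. indet (inv_into J e (e x))" indet] e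
    by (simp add: psubst_psubst)
  have "?to p * ?to q = 0" using assms psubst_mult[symmetric] psubst_0 by metis
  then have "?to p = 0 \<or> ?to q = 0" by simp
  then show ?thesis using undo J psubst_0 by metis
qed

lemma mpoly_prod_eq_0_iff [simp]:
  fixes p q :: "('x, 'k::idom) mpoly"
  shows "p * q = 0 \<longleftrightarrow> p = 0 \<or> q = 0"
  using mpoly_mult_eq_0D by auto

lemma indet_eq_iff [simp]: "indet x = (indet y :: ('x, 'k::comm_ring_1) mpoly) \<longleftrightarrow> x = y"
proof
  assume "indet x = (indet y :: ('x, 'k) mpoly)"
  then have "Poly_Mapping.lookup (indet x :: ('x, 'k) mpoly) (Poly_Mapping.single x 1) =
      Poly_Mapping.lookup (indet y) (Poly_Mapping.single x 1)" by simp
  then have "Poly_Mapping.single y (1::nat) = Poly_Mapping.single x 1"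
    by (simp add: indet_def lookup_single when_def split: if_splits)
  then have "Poly_Mapping.lookup (Poly_Mapping.single y (1::nat)) x = 1" by simp
  then show "x = y" by (simp add: lookup_single when_def split: if_splits)
qed simp

lemma indet_neq_0 [simp]: "indet x \<noteq> 0"
  unfolding indet_def by (metis lookup_single_eq lookup_zero zero_neq_one)

section \<open>Chains of prime ideals\<close>

lemma primeideal_poly_ringI:
  assumes "P \<subseteq> polys I" "0 \<in> P" "1 \<notin> P"
    and "\<And>p q. p \<in> P \<Longrightarrow> q \<in> P \<Longrightarrow> p + q \<in> P"
    and mult: "\<And>p q. p \<in> polys I \<Longrightarrow> q \<in> P \<Longrightarrow> p * q \<in> P"
    and "\<And>p q. p \<in> polys I \<Longrightarrow> q \<in> polys I \<Longrightarrow> p * q \<in> P \<Longrightarrow> p \<in> P \<or> q \<in> P"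
  shows "primeideal P (poly_ring I)"
proof -
  interpret cring "poly_ring I :: ('a, 'b) mpoly ring" by (rule cring_poly_ring)
  have inv: "inv\<^bsub>add_monoid (poly_ring I)\<^esub> p = - p" if "p \<in> polys I" for p :: "('a, 'b) mpoly"
    using minus_equality[of "- p" p] that by (simp add: a_inv_def)
  show ?thesis
  proof (rule primeidealI)
    show "ideal P (poly_ring I)"
    proof (rule idealI)
      show "subgroup P (add_monoid (poly_ring I))"
        using assms(1,2,4) mult[of "- 1"] by unfold_locales (auto simp: inv[simplified] subset_iff)
      show "q \<otimes>\<^bsub>poly_ring I\<^esub> p \<in> P" if "q \<in> P" "p \<in> polys I" for p q
        using mult[OF that(2,1)] by (simp add: mult.commute)
    qed (use mult ring_axioms in auto)
    show "polys I \<noteq> P" using assms(3) polys_1 by blast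
  qed (use assms in \<open>auto simp: is_cring\<close>)
qed

context
  fixes P :: "('x, 'k::comm_ring_1) mpoly set" and I :: "'x set"
  assumes P: "primeideal P (poly_ring I)"
begin

interpretation primeideal P "poly_ring I" by (rule P)

lemma primeideal_subset: "p \<in> P \<Longrightarrow> p \<in> polys I"
  by (rule a_Hcarr)

lemma primeideal_0: "0 \<in> P"
  using additive_subgroup.zero_closed[OF additive_subgroup_axioms] by simp

lemma primeideal_add: "p \<in> P \<Longrightarrow> q \<in> P \<Longrightarrow> p + q \<in> P"
  using additive_subgroup.a_closed[OF additive_subgroup_axioms, of p q] by simp

lemma primeideal_mult: "p \<in> polys I \<Longrightarrow> q \<in> P \<Longrightarrow> p * q \<in> P"
  using I_l_closed[of q p] by simp

lemma primeideal_diff: "p \<in> P \<Longrightarrow> q \<in> P \<Longrightarrow> p - q \<in> P"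
  using primeideal_add[of p "- 1 * q"] primeideal_mult[of "- 1" q] by simp

lemma primeideal_prime: "p \<in> polys I \<Longrightarrow> q \<in> polys I \<Longrightarrow> p * q \<in> P \<Longrightarrow> p \<in> P \<or> q \<in> P"
  using I_prime[of p q] by simp

end

definition psubst_kernel :: "'x set \<Rightarrow> ('x \<Rightarrow> ('y, 'k) mpoly) \<Rightarrow> ('x, 'k::comm_ring_1) mpoly set" where
  "psubst_kernel I f = {p \<in> polys I. psubst f p = 0}"

text \<open>The kernel of a homomorphism into an integral domain is prime.\<close>

lemma primeideal_psubst_kernel:
  fixes f :: "'x \<Rightarrow> ('y, 'k::idom) mpoly"
  shows "primeideal (psubst_kernel I f) (poly_ring I)"
  by (rule primeideal_poly_ringI) (auto simp: psubst_kernel_def)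

text \<open>\<open>k\<close> counts the strict inclusions, so \<open>height R P\<close> is the
  supremum of all \<open>k\<close> with \<open>prime_chain R k P\<close>.\<close>

definition prime_chain :: "('a, 'b) ring_scheme \<Rightarrow> nat \<Rightarrow> 'a set \<Rightarrow> bool" where
  "prime_chain R k P \<longleftrightarrow> (\<exists>C :: nat \<Rightarrow> 'a set.
     (\<forall>i\<le>k. primeideal (C i) R) \<and> (\<forall>i<k. C i \<subset> C (Suc i)) \<and> C k = P)"

lemma height_eqI:
  assumes "prime_chain R k P" "\<And>j. prime_chain R j P \<Longrightarrow> j \<le> k"
  shows "height R P = enat k"
  unfolding height_def prime_chain_def[symmetric]
  by (rule antisym) (auto intro!: Sup_least Sup_upper assms)

lemma prime_chain_0: "primeideal P R \<Longrightarrow> prime_chain R 0 P"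
  unfolding prime_chain_def by (intro exI[of _ "\<lambda>_. P"]) simp

lemma prime_chain_Suc:
  assumes "prime_chain R k P" "P \<subset> Q" "primeideal Q R"
  shows "prime_chain R (Suc k) Q"
proof -
  obtain C where "\<forall>i\<le>k. primeideal (C i) R" "\<forall>i<k. C i \<subset> C (Suc i)" "C k = P"
    using assms(1) by (auto simp: prime_chain_def)
  then show ?thesis
    unfolding prime_chain_def using assms
    by (intro exI[of _ "C(Suc k := Q)"]) (auto simp: less_Suc_eq le_Suc_eq)
qed

text \<open>Only the top member is replaced, and enlarging it keeps the last inclusion
  strict.\<close>

lemma prime_chain_superset:
  assumes "prime_chain R k P" "P \<subseteq> Q" "primeideal Q R"
  shows "prime_chain R k Q"
proof -
  obtain C where C: "\<forall>i\<le>k. primeideal (C i) R" "\<forall>i<k. C i \<subset> C (Suc i)" "C k = P"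
    using assms(1) by (auto simp: prime_chain_def)
  have "(C(k := Q)) i \<subset> (C(k := Q)) (Suc i)" if "i < k" for i
  proof (cases "Suc i = k")
    case True
    then show ?thesis using C assms(2) that by auto
  next
    case False
    then show ?thesis using C that by simp
  qed
  then show ?thesis
    unfolding prime_chain_def using assms C
    by (intro exI[of _ "C(k := Q)"]) auto
qed

section \<open>Algebraic independence and the length of prime chains\<close>

lemma polys_insert_univariate:
  assumes "F \<in> polys (insert x J)"
  shows "\<exists>q. (\<forall>i. coeff q i \<in> polys J) \<and> F = poly q (indet x)"
  using assms
proof (induction F rule: polys_induct)
  case (const c)
  show ?case by (rule exI[of _ "[:const c:]"]) (simp add: coeff_pCons split: nat.split)
next
  case (indet y)
  show ?case
  proof (cases "y = x")
    case True
    then show ?thesis by (intro exI[of _ "[:0, 1:]"]) (simp add: coeff_pCons split: nat.split)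
  next
    case False
    then show ?thesis using indet
      by (intro exI[of _ "[:indet y:]"]) (simp add: coeff_pCons split: nat.split)
  qed
next
  case (add p q)
  then obtain a b where "\<forall>i. coeff a i \<in> polys J" "p = poly a (indet x)"
    "\<forall>i. coeff b i \<in> polys J" "q = poly b (indet x)" by blast
  then show ?case by (intro exI[of _ "a + b"]) simp
next
  case (mult p q)
  then obtain a b where "\<forall>i. coeff a i \<in> polys J" "p = poly a (indet x)"
    "\<forall>i. coeff b i \<in> polys J" "q = poly b (indet x)" by blast
  then show ?case by (intro exI[of _ "a * b"]) (simp add: coeff_mult polys_sum)
qed

text \<open>
  Read \<open>F\<close> as a univariate polynomial in the last indeterminate: modulo \<open>D\<close> only its constant
  term survives, which must vanish, and then \<open>f\<close> cancels modulo the prime \<open>C\<close>.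
\<close>

lemma alg_indep_mod_smaller_prime:
  fixes C D :: "('x, 'k::field) mpoly set"
  assumes C: "primeideal C (poly_ring I)" and D: "primeideal D (poly_ring I)"
    and CD: "C \<subseteq> D" and f: "f \<in> D" "f \<notin> C"
    and g: "\<And>i. i < n \<Longrightarrow> g i \<in> polys I"
    and ind: "\<And>F. F \<in> polys {..<n} \<Longrightarrow> psubst g F \<in> D \<Longrightarrow> F = 0"
    and F: "F \<in> polys {..<Suc n}" "psubst (g(n := f)) F \<in> C"
  shows "F = 0"
proof -
  let ?g = "g(n := f)"
  have fI: "f \<in> polys I" using primeideal_subset[OF D f(1)] .
  have clos: "psubst ?g p \<in> polys I" if "p \<in> polys {..<Suc n}" for p
    using that by (rule psubst_in_polys) (use fI g in auto)
  have "poly q (indet n) = 0"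
    if "\<forall>i. coeff q i \<in> polys {..<n}" "psubst ?g (poly q (indet n)) \<in> C" for q
    using that
  proof (induction q)
    case (pCons a q)
    have coef: "a \<in> polys {..<n}" "\<forall>i. coeff q i \<in> polys {..<n}"
      using pCons.prems(1) by (auto simp: coeff_pCons split: nat.splits)
    then have "coeff q i \<in> polys {..<Suc n}" for i
      using polys_mono[of "{..<n}" "{..<Suc n}"] by auto
    then have q: "poly q (indet n) \<in> polys {..<Suc n}"
      unfolding poly_altdef by (intro polys_sum polys_mult polys_power) auto
    have a: "psubst ?g a = psubst g a"
      using coef(1) by (rule psubst_cong) auto
    have s: "psubst g a + f * psubst ?g (poly q (indet n)) \<in> C"
      using pCons.prems(2) a by (simp del: fun_upd_apply add: fun_upd_same)
    moreover have "f * psubst ?g (poly q (indet n)) \<in> D"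
      using primeideal_mult[OF D clos[OF q] f(1)] by (simp add: mult.commute)
    ultimately have "psubst g a \<in> D" using primeideal_diff[OF D] CD by (metis add_diff_cancel_right' subsetD)
    then have "a = 0" using ind coef by blast
    then have "psubst ?g (poly q (indet n)) \<in> C"
      using s primeideal_prime[OF C fI clos[OF q]] f(2) by simp
    then show ?case using \<open>a = 0\<close> pCons.IH[OF coef(2)] by (simp del: fun_upd_apply)
  qed simp
  moreover obtain q where "\<forall>i. coeff q i \<in> polys {..<n}" "F = poly q (indet n)"
    using polys_insert_univariate[of F n "{..<n}"] F(1) by (auto simp: lessThan_Suc)
  ultimately show ?thesis using F(2) by blast
qed

text \<open>Each exponent is bounded separately, rather than the total degree, so that for finite
  \<open>J\<close> the box has exactly \<open>(d + 1) ^ card J\<close> elements.\<close>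

definition exponent_box :: "'x set \<Rightarrow> nat \<Rightarrow> ('x \<Rightarrow>\<^sub>0 nat) set" where
  "exponent_box J d = {m. Poly_Mapping.keys m \<subseteq> J \<and> (\<forall>x. Poly_Mapping.lookup m x \<le> d)}"

lemma exponent_box_card:
  assumes "finite J"
  shows "finite (exponent_box J d)" "card (exponent_box J d) = (d + 1) ^ card J"
proof -
  have bij: "bij_betw (\<lambda>m. restrict (Poly_Mapping.lookup m) J) (exponent_box J d) (J \<rightarrow>\<^sub>E {..d})"
  proof (rule bij_betw_imageI)
    show "inj_on (\<lambda>m. restrict (Poly_Mapping.lookup m) J) (exponent_box J d)"
    proof (rule inj_onI)
      fix m n assume mn: "m \<in> exponent_box J d" "n \<in> exponent_box J d"
        "restrict (Poly_Mapping.lookup m) J = restrict (Poly_Mapping.lookup n) J"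
      have "Poly_Mapping.lookup m x = Poly_Mapping.lookup n x" for x
      proof (cases "x \<in> J")
        case True
        then show ?thesis using mn(3) by (metis restrict_apply')
      next
        case False
        then have "x \<notin> Poly_Mapping.keys m" "x \<notin> Poly_Mapping.keys n"
          using mn by (auto simp: exponent_box_def)
        then show ?thesis by (simp add: in_keys_iff)
      qed
      then show "m = n" by (rule poly_mapping_eqI)
    qed
    show "(\<lambda>m. restrict (Poly_Mapping.lookup m) J) ` exponent_box J d = (J \<rightarrow>\<^sub>E {..d})"
    proof (intro equalityI subsetI)
      fix h assume h: "h \<in> J \<rightarrow>\<^sub>E {..d}"
      define m where "m = Abs_poly_mapping (\<lambda>x. if x \<in> J then h x else 0)"
      have "finite {x. (if x \<in> J then h x else 0) \<noteq> 0}"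
        using assms by (rule rev_finite_subset) auto
      then have m: "Poly_Mapping.lookup m = (\<lambda>x. if x \<in> J then h x else 0)"
        unfolding m_def by (rule lookup_Abs_poly_mapping)
      have "m \<in> exponent_box J d"
        using h by (auto simp: exponent_box_def in_keys_iff m split: if_splits)
      moreover have "h = restrict (Poly_Mapping.lookup m) J"
      proof
        fix x
        show "h x = restrict (Poly_Mapping.lookup m) J x"
          using PiE_arb[OF h, of x] by (simp add: m restrict_def)
      qed
      ultimately show "h \<in> (\<lambda>m. restrict (Poly_Mapping.lookup m) J) ` exponent_box J d" by blast
    qed (auto simp: exponent_box_def)
  qed
  show "finite (exponent_box J d)" using bij_betw_finite[OF bij] assms by (simp add: finite_PiE)
  show "card (exponent_box J d) = (d + 1) ^ card J"
    using bij_betw_same_card[OF bij] assms by (simp add: card_PiE)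
qed

definition polys_box :: "'x set \<Rightarrow> nat \<Rightarrow> ('x, 'k::comm_ring_1) mpoly set" where
  "polys_box J d = {p. Poly_Mapping.keys p \<subseteq> exponent_box J d}"

lemma polys_box_1: "1 \<in> polys_box J 0"
  by (auto simp: polys_box_def exponent_box_def)

lemma polys_box_mono:
  assumes "d \<le> e"
  shows "polys_box J d \<subseteq> polys_box J e"
proof -
  have "exponent_box J d \<subseteq> exponent_box J e"
    using order_trans[OF _ assms] by (auto simp: exponent_box_def)
  then show ?thesis by (auto simp: polys_box_def)
qed

lemma polys_box_mult:
  assumes "p \<in> polys_box J d" "q \<in> polys_box J e"
  shows "p * q \<in> polys_box J (d + e)"
  unfolding polys_box_def
proof (intro CollectI subsetI)
  fix m assume "m \<in> Poly_Mapping.keys (p * q)"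
  then obtain a b where m: "m = a + b" "a \<in> Poly_Mapping.keys p" "b \<in> Poly_Mapping.keys q"
    using keys_mult[of p q] by blast
  then have "a \<in> exponent_box J d" "b \<in> exponent_box J e" using assms by (auto simp: polys_box_def)
  then show "m \<in> exponent_box J (d + e)"
    using Poly_Mapping.keys_add[of a b] m by (auto simp: exponent_box_def lookup_add intro: add_mono)
qed

lemma polys_box_power: "p \<in> polys_box J d \<Longrightarrow> p ^ n \<in> polys_box J (n * d)"
  by (induction n) (auto intro: polys_box_1 polys_box_mult)

lemma polys_box_prod:
  assumes "finite A" "\<And>i. i \<in> A \<Longrightarrow> f i \<in> polys_box J d"
  shows "prod f A \<in> polys_box J (card A * d)"
  using assms by (induction A rule: finite_induct) (auto intro: polys_box_1 polys_box_mult)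

lemma polys_in_box:
  assumes "p \<in> polys J"
  shows "\<exists>d. p \<in> polys_box J d"
proof -
  define d where "d = (\<Sum>m\<in>Poly_Mapping.keys p. \<Sum>x\<in>Poly_Mapping.keys m. Poly_Mapping.lookup m x)"
  have "Poly_Mapping.lookup m x \<le> d" if m: "m \<in> Poly_Mapping.keys p" for m x
  proof (cases "x \<in> Poly_Mapping.keys m")
    case True
    have "Poly_Mapping.lookup m x \<le> (\<Sum>x\<in>Poly_Mapping.keys m. Poly_Mapping.lookup m x)"
      using True by (intro member_le_sum) auto
    also have "\<dots> \<le> d" unfolding d_def using m
      by (intro member_le_sum[of m _ "\<lambda>m. \<Sum>x\<in>Poly_Mapping.keys m. Poly_Mapping.lookup m x"]) auto
    finally show ?thesis .
  qed (simp add: in_keys_iff)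
  then show ?thesis using assms by (intro exI[of _ d]) (auto simp: polys_box_def exponent_box_def polys_iff)
qed

lemma vector_space_mpoly: "vector_space (\<lambda>c (p :: ('x, 'k::field) mpoly). const c * p)"
  by unfold_locales (simp_all add: single_add mult_single[of 0 _ 0, simplified] algebra_simps)

text \<open>
  Monomials with exponents at most \<open>d\<close> number about \<open>d\<^sup>N\<close>, but their images lie in a space of
  dimension of order \<open>d ^ card I\<close>.
\<close>

lemma alg_indep_le_card:
  fixes g :: "nat \<Rightarrow> ('x, 'k::field) mpoly"
  assumes fin: "finite I" and g: "\<And>i. i < N \<Longrightarrow> g i \<in> polys I"
    and ind: "\<And>F. F \<in> polys {..<N} \<Longrightarrow> psubst g F = 0 \<Longrightarrow> F = 0"
  shows "N \<le> card I"
proof (rule ccontr)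
  assume "\<not> N \<le> card I"
  then have N: "card I < N" by simp
  interpret vs: vector_space "\<lambda>c (p :: ('x, 'k) mpoly). const c * p" by (rule vector_space_mpoly)
  have "\<exists>e. g i \<in> polys_box I e" if "i < N" for i using polys_in_box g that by blast
  then obtain e' where e': "\<And>i. i < N \<Longrightarrow> g i \<in> polys_box I (e' i)" by metis
  define e where "e = (\<Sum>i<N. e' i)"
  have "e' i \<le> e" if "i < N" for i
    unfolding e_def using that by (intro member_le_sum) auto
  then have e: "g i \<in> polys_box I e" if "i < N" for i
    using e' polys_box_mono that by blast
  \<comment> \<open>Chosen to absorb the constant factor of the final estimate, where
    \<open>d < d + 1\<close> then decides the comparison with \<open>(d + 1) ^ N\<close>.\<close>
  define d where "d = (N * e + 1) ^ card I"
  let ?A = "exponent_box {..<N} d" and ?M = "exponent_box I (N * (d * e))"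
  define \<phi> where "\<phi> a = psubst g (Poly_Mapping.single a 1)" for a
  have A: "finite ?A" "card ?A = (d + 1) ^ N" using exponent_box_card[of "{..<N}" d] by simp_all
  have M: "finite ?M" "card ?M = (N * (d * e) + 1) ^ card I" using exponent_box_card[OF fin] by simp_all
  \<comment> \<open>A linear relation among images of monomials is the image of the polynomial with
    these coefficients, which independence forces to be zero.\<close>
  have lin: "u a = 0" if "(\<Sum>a\<in>?A. const (u a) * \<phi> a) = 0" "a \<in> ?A" for u a
  proof -
    let ?F = "\<Sum>a\<in>?A. Poly_Mapping.single a (u a)"
    have "psubst g ?F = (\<Sum>a\<in>?A. const (u a) * \<phi> a)"
      by (simp add: psubst_sum psubst_single \<phi>_def)
    moreover have "?F \<in> polys {..<N}"
      by (intro polys_sum) (auto simp: polys_iff exponent_box_def)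
    ultimately have "?F = 0" using ind that(1) by simp
    then have "Poly_Mapping.lookup ?F a = 0" by simp
    then show ?thesis using that(2) A(1) by (simp add: lookup_sum lookup_single when_def)
  qed
  have inj: "inj_on \<phi> ?A"
  proof (rule inj_onI, rule ccontr)
    fix a b assume ab: "a \<in> ?A" "b \<in> ?A" "\<phi> a = \<phi> b" "a \<noteq> b"
    \<comment> \<open>A coincidence of two images is the linear relation with coefficients 1 and -1.
      Injectivity turns relations over the image set into relations over the box.\<close>
    define u where "u x = (if x = a then 1 else 0) + (if x = b then - 1 else 0 :: 'k)" for x
    have "(\<Sum>x\<in>?A. const (u x) * \<phi> x) =
        (\<Sum>x\<in>?A. if x = a then \<phi> a else 0) + (\<Sum>x\<in>?A. if x = b then - \<phi> b else 0)"
      unfolding sum.distrib[symmetric]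
      by (intro sum.cong) (auto simp: u_def single_uminus)
    also have "\<dots> = 0" using ab A(1) by simp
    finally show False using lin[of u a] ab by (simp add: u_def)
  qed
  have "vs.independent (\<phi> ` ?A)"
  proof
    assume "vs.dependent (\<phi> ` ?A)"
    then obtain u v where u: "v \<in> \<phi> ` ?A" "u v \<noteq> 0" "(\<Sum>v\<in>\<phi> ` ?A. const (u v) * v) = 0"
      using vs.dependent_finite[of "\<phi> ` ?A"] A(1) by auto
    then have "(\<Sum>a\<in>?A. const (u (\<phi> a)) * \<phi> a) = 0" by (simp add: sum.reindex[OF inj] o_def)
    then show False using lin[of "\<lambda>a. u (\<phi> a)"] u by auto
  qed
  moreover have "\<phi> ` ?A \<subseteq> vs.span ((\<lambda>m. Poly_Mapping.single m 1) ` ?M)"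
  proof (intro image_subsetI)
    fix a assume a: "a \<in> ?A"
    have "\<phi> a = (\<Prod>i<N. g i ^ Poly_Mapping.lookup a i)"
      using a unfolding \<phi>_def psubst_single
      by (subst monom_subst_superset[of "{..<N}"]) (auto simp: exponent_box_def)
    moreover have "g i ^ Poly_Mapping.lookup a i \<in> polys_box I (d * e)" if "i < N" for i
      using polys_box_power[OF e[OF that], of "Poly_Mapping.lookup a i"] a
        polys_box_mono[of "Poly_Mapping.lookup a i * e" "d * e" I]
      by (auto simp: exponent_box_def intro: mult_right_mono)
    ultimately have "\<phi> a \<in> polys_box I (N * (d * e))"
      using polys_box_prod[of "{..<N}" "\<lambda>i. g i ^ Poly_Mapping.lookup a i" I "d * e"] by simp
    then have sub: "Poly_Mapping.keys (\<phi> a) \<subseteq> ?M" by (simp add: polys_box_def)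
    have "\<phi> a = (\<Sum>m\<in>Poly_Mapping.keys (\<phi> a). const (Poly_Mapping.lookup (\<phi> a) m) * Poly_Mapping.single m 1)"
      by (subst poly_mapping_expand) (simp add: mult_single)
    also have "\<dots> \<in> vs.span ((\<lambda>m. Poly_Mapping.single m 1) ` ?M)"
      using sub by (intro vs.span_sum vs.span_scale vs.span_base) auto
    finally show "\<phi> a \<in> vs.span ((\<lambda>m. Poly_Mapping.single m 1) ` ?M)" .
  qed
  ultimately have "card (\<phi> ` ?A) \<le> card ((\<lambda>m. Poly_Mapping.single m (1::'k)) ` ?M)"
    using vs.independent_span_bound M(1) by blast
  also have "\<dots> \<le> card ?M" using M(1) by (rule card_image_le)
  finally have "(d + 1) ^ N \<le> (N * (d * e) + 1) ^ card I"
    using A M by (simp add: card_image[OF inj])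
  also have "\<dots> \<le> ((N * e + 1) * (d + 1)) ^ card I"
    by (intro power_mono) (simp_all add: algebra_simps)
  also have "\<dots> = d * (d + 1) ^ card I" by (simp only: power_mult_distrib d_def[symmetric])
  also have "\<dots> < (d + 1) * (d + 1) ^ card I" by simp
  also have "\<dots> = (d + 1) ^ Suc (card I)" by simp
  also have "\<dots> \<le> (d + 1) ^ N" using N by (intro power_increasing) auto
  finally show False by simp
qed

text \<open>The indeterminates in \<open>B\<close> are algebraically independent modulo
  \<open>P\<close>. Each step down the chain adds one element by
  \<open>alg_indep_mod_smaller_prime\<close>, so at the bottom \<open>polys I\<close> contains
  \<open>k + card B\<close> algebraically independent elements.\<close>

lemma prime_chain_le:
  fixes P :: "('x, 'k::field) mpoly set"
  assumes fin: "finite I" and B: "B \<subseteq> I" and PB: "P \<inter> polys B \<subseteq> {0}"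
    and chain: "prime_chain (poly_ring I) k P"
  shows "k + card B \<le> card I"
proof -
  obtain C where C: "\<And>i. i \<le> k \<Longrightarrow> primeideal (C i) (poly_ring I)"
    "\<And>i. i < k \<Longrightarrow> C i \<subset> C (Suc i)" "C k = P"
    using chain by (auto simp: prime_chain_def)
  have "\<exists>g. (\<forall>i < j + card B. g i \<in> polys I) \<and>
      (\<forall>F \<in> polys {..<j + card B}. psubst g F \<in> C (k - j) \<longrightarrow> F = 0)" if "j \<le> k" for j
    using that
  proof (induction j)
    case 0
    have "finite B" using fin B finite_subset by blast
    then obtain h where h: "bij_betw h {..<card B} B"
      using ex_bij_betw_nat_finite[of B] by (auto simp: lessThan_atLeast0)
    have hB: "h i \<in> B" if "i < card B" for i using h that by (auto simp: bij_betw_def)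
    have "F = 0" if F: "F \<in> polys {..<card B}" "psubst (\<lambda>i. indet (h i)) F \<in> P" for F :: "(nat, 'k) mpoly"
    proof -
      have "psubst (\<lambda>i. indet (h i)) F \<in> polys B"
        using F(1) by (rule psubst_in_polys) (simp add: hB)
      then have "psubst (\<lambda>i. indet (h i)) F = 0" using F(2) PB by blast
      moreover have "psubst (\<lambda>x. indet (inv_into {..<card B} h x)) (psubst (\<lambda>i. indet (h i)) F) = psubst indet F"
        unfolding psubst_psubst using F(1)
        by (rule psubst_cong) (use h in \<open>auto simp: bij_betw_def\<close>)
      ultimately show ?thesis by simp
    qed
    moreover have "indet (h i) \<in> polys I" if "i < card B" for i
      using hB[OF that] B by (intro polys_indet) blast
    ultimately show ?case using C(3) by (intro exI[of _ "\<lambda>i. indet (h i)"]) auto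
  next
    case (Suc j)
    then obtain g where g: "\<And>i. i < j + card B \<Longrightarrow> g i \<in> polys I"
      "\<And>F. F \<in> polys {..<j + card B} \<Longrightarrow> psubst g F \<in> C (k - j) \<Longrightarrow> F = 0" by auto
    have sub: "C (k - Suc j) \<subset> C (k - j)" using C(2)[of "k - Suc j"] Suc.prems by (simp add: Suc_diff_Suc)
    then obtain f where f: "f \<in> C (k - j)" "f \<notin> C (k - Suc j)" by blast
    have pr: "primeideal (C (k - Suc j)) (poly_ring I)" "primeideal (C (k - j)) (poly_ring I)"
      using C(1) by auto
    show ?case
    proof (intro exI[of _ "g(j + card B := f)"] conjI ballI allI impI)
      fix i assume "i < Suc j + card B"
      then show "(g(j + card B := f)) i \<in> polys I"
        using g(1) primeideal_subset[OF pr(2) f(1)] by (auto simp: less_Suc_eq)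
    next
      fix F assume "F \<in> polys {..<Suc j + card B}" "psubst (g(j + card B := f)) F \<in> C (k - Suc j)"
      then show "F = 0"
        using alg_indep_mod_smaller_prime[OF pr _ f g, where F = F] sub by simp
    qed
  qed
  from this[of k] obtain g where "\<And>i. i < k + card B \<Longrightarrow> g i \<in> polys I"
    "\<And>F. F \<in> polys {..<k + card B} \<Longrightarrow> psubst g F \<in> C 0 \<Longrightarrow> F = 0" by auto
  then show ?thesis
    using primeideal_0[OF C(1)[of 0]] by (intro alg_indep_le_card[OF fin, of _ g]) auto
qed

text \<open>Here \<open>f'\<close> factors through \<open>f\<close> by way of \<open>h\<close>;
  exhibiting such an \<open>h\<close> gives the inclusions in the chains below.\<close>

lemma psubst_kernel_mono:
  assumes "\<And>x. x \<in> I \<Longrightarrow> f' x = psubst h (f x)"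
  shows "psubst_kernel I f \<subseteq> psubst_kernel I f'"
proof
  fix p assume "p \<in> psubst_kernel I f"
  then have p: "p \<in> polys I" "psubst f p = 0" by (auto simp: psubst_kernel_def)
  have "psubst f' p = psubst h (psubst f p)"
    unfolding psubst_psubst using p(1) assms by (rule psubst_cong)
  then show "p \<in> psubst_kernel I f'" using p by (simp add: psubst_kernel_def)
qed

section \<open>Minimal primes of binomial edge ideals\<close>

definition kill :: "'x set \<Rightarrow> 'x \<Rightarrow> ('x, 'k::comm_ring_1) mpoly" where
  "kill Z x = (if x \<in> Z then 0 else indet x)"

text \<open>Indeterminates are killed one at a time, each new one witnessing that the inclusion is
  strict.\<close>

lemma prime_chain_kill:
  assumes "finite Z" "Z \<subseteq> I"
  shows "prime_chain (poly_ring I) (card Z) (psubst_kernel I (kill Z :: 'x \<Rightarrow> ('x, 'k::field) mpoly))"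
  using assms
proof (induction Z rule: finite_induct)
  case empty
  show ?case by (simp add: prime_chain_0 primeideal_psubst_kernel)
next
  case (insert x Z)
  let ?K = "\<lambda>Z. psubst_kernel I (kill Z :: 'x \<Rightarrow> ('x, 'k) mpoly)"
  have "?K Z \<subseteq> ?K (insert x Z)"
    by (rule psubst_kernel_mono[where h = "kill {x}"]) (simp add: kill_def)
  moreover have "indet x \<in> ?K (insert x Z) - ?K Z"
    using insert by (simp add: psubst_kernel_def kill_def)
  ultimately have "?K Z \<subset> ?K (insert x Z)" by blast
  then show ?case
    using prime_chain_Suc[OF _ _ primeideal_psubst_kernel] insert by simp
qed

section \<open>Primes of rank-one substitutions and their heights\<close>

abbreviation bei_vars :: "'v set \<Rightarrow> 'v bei_var set" where
  "bei_vars V \<equiv> X ` V \<union> Y ` V"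

text \<open>
  The columns \<open>(x\<^sub>i, y\<^sub>i)\<close> with \<open>i \<in> S\<close> are sent to zero, the others to multiples \<open>x\<^sub>i (1, t\<^sub>r)\<close> of
  one vector for each block \<open>r\<close>, so the kernel consists of the polynomials vanishing when the
  columns of each block are parallel.
\<close>

definition rank_one_subst :: "'v set \<Rightarrow> ('v \<Rightarrow> 'v) \<Rightarrow> 'v bei_var \<Rightarrow> ('v bei_var, 'k::comm_ring_1) mpoly"
  where
  "rank_one_subst S r w = (case w of
     X i \<Rightarrow> if i \<in> S then 0 else indet (X i)
   | Y i \<Rightarrow> if i \<in> S then 0 else indet (X i) * indet (Y (r i)))"

lemma rank_one_subst_simps [simp]:
  "i \<in> S \<Longrightarrow> rank_one_subst S r (X i) = 0" "i \<notin> S \<Longrightarrow> rank_one_subst S r (X i) = indet (X i)"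
  "i \<in> S \<Longrightarrow> rank_one_subst S r (Y i) = 0"
  "i \<notin> S \<Longrightarrow> rank_one_subst S r (Y i) = indet (X i) * indet (Y (r i))"
  by (simp_all add: rank_one_subst_def)

text \<open>With \<open>r = comp_rep E (V - S)\<close> this is the prime \<open>P\<^sub>S\<close>
  attached to \<open>S\<close>. Leaving \<open>r\<close> arbitrary admits the finer partitions that
  occur along the chain below it.\<close>

definition component_prime ::
    "'v set \<Rightarrow> 'v set \<Rightarrow> ('v \<Rightarrow> 'v) \<Rightarrow> ('v bei_var, 'k::comm_ring_1) mpoly set" where
  "component_prime V S r = psubst_kernel (bei_vars V) (rank_one_subst S r)"

abbreviation minor :: "'v \<Rightarrow> 'v \<Rightarrow> ('v bei_var, 'k::comm_ring_1) mpoly" where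
  "minor i j \<equiv> indet (X i) * indet (Y j) - indet (X j) * indet (Y i)"

lemma minor_in_polys [simp]: "i \<in> V \<Longrightarrow> j \<in> V \<Longrightarrow> minor i j \<in> polys (bei_vars V)"
  by (intro polys_diff polys_mult polys_indet) auto

lemma primeideal_component_prime:
  "primeideal (component_prime V S r :: ('v bei_var, 'k::field) mpoly set) (bei_ring V)"
  unfolding component_prime_def bei_ring_def by (rule primeideal_psubst_kernel)

lemma minor_in_component_prime:
  fixes V :: "'v set"
  assumes "i \<in> V" "j \<in> V" "i \<notin> S" "j \<notin> S"
  shows "(minor i j :: ('v bei_var, 'k::field) mpoly) \<in> component_prime V S r \<longleftrightarrow> r i = r j"
proof -
  have "psubst (rank_one_subst S r) (minor i j :: ('v bei_var, 'k) mpoly) =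
      indet (X i) * (indet (X j) * (indet (Y (r j)) - indet (Y (r i))))"
    using assms by (simp add: algebra_simps)
  moreover have "\<dots> = 0 \<longleftrightarrow> r i = r j" by auto
  ultimately show ?thesis
    using assms by (simp add: component_prime_def psubst_kernel_def)
qed

text \<open>Killing the columns of \<open>S\<close> contributes \<open>2 * card S\<close> steps;
  then each vertex that does not represent itself is merged into its block, one step each.\<close>

lemma prime_chain_component_prime:
  fixes V :: "'v set"
  assumes fin: "finite V" and S: "S \<subseteq> V"
    and idem: "\<And>i. i \<in> V - S \<Longrightarrow> r (r i) = r i" and rV: "\<And>i. i \<in> V - S \<Longrightarrow> r i \<in> V - S"
  shows "prime_chain (bei_ring V) (2 * card S + card {i \<in> V - S. r i \<noteq> i})
    (component_prime V S r :: ('v bei_var, 'k::field) mpoly set)"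
proof -
  have finS: "finite S" using fin S finite_subset by blast
  let ?P = "\<lambda>r. component_prime V S r :: ('v bei_var, 'k) mpoly set"
  \<comment> \<open>\<open>W\<close> collects the vertices merged so far; every other one is still
    its own representative.\<close>
  have merge: "prime_chain (bei_ring V) (2 * card S + card W) (?P (\<lambda>i. if i \<in> W then r i else i))"
    if "finite W" "W \<subseteq> {i \<in> V - S. r i \<noteq> i}" for W
    using that
  proof (induction W rule: finite_induct)
    case empty
    have "card (bei_vars S) = 2 * card S"
      using finS by (subst card_Un_disjoint) (auto simp: card_image inj_on_def)
    moreover have "bei_vars S \<subseteq> bei_vars V" "finite (bei_vars S)" using S finS by auto
    ultimately have "prime_chain (bei_ring V) (2 * card S)
        (psubst_kernel (bei_vars V) (kill (bei_vars S)) :: ('v bei_var, 'k) mpoly set)"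
      unfolding bei_ring_def using prime_chain_kill by metis
    \<comment> \<open>With every vertex its own representative, the rank-one substitution factors
      through \<open>kill (bei_vars S)\<close>, so its kernel can replace the top of the
      chain.\<close>
    moreover have "psubst_kernel (bei_vars V) (kill (bei_vars S)) \<subseteq> ?P (\<lambda>i. i)"
      unfolding component_prime_def
      by (rule psubst_kernel_mono[where h = "rank_one_subst S (\<lambda>i. i)"])
        (auto simp: kill_def rank_one_subst_def)
    ultimately have "prime_chain (bei_ring V) (2 * card S) (?P (\<lambda>i. i))"
      by (rule prime_chain_superset[OF _ _ primeideal_component_prime])
    then show ?case by simp
  next
    case (insert i W)
    let ?r = "\<lambda>W j. if j \<in> W then r j else j"
    have i: "i \<in> V - S" "r i \<noteq> i" using insert by auto
    have "?P (?r W) \<subseteq> ?P (?r (insert i W))"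
      unfolding component_prime_def
    proof (rule psubst_kernel_mono[where h = "indet(Y i := indet (Y (r i)))"])
      fix w assume "w \<in> bei_vars V"
      \<comment> \<open>\<open>h\<close> redirects the parameter of \<open>i\<close> to that of
        \<open>r i\<close>. It leaves the vertices merged earlier alone, because
        \<open>r j = i\<close> would make \<open>i\<close> its own representative.\<close>
      have "r j \<noteq> i" if "j \<in> W" for j
        using that insert.prems idem[of j] by auto
      then show "rank_one_subst S (?r (insert i W)) w =
          psubst (indet(Y i := indet (Y (r i)))) (rank_one_subst S (?r W) w)"
        by (cases w) (auto simp: rank_one_subst_def)
    qed
    moreover have "minor i (r i) \<in> ?P (?r (insert i W)) - ?P (?r W)"
      using i rV[OF i(1)] idem[OF i(1)] insert.hyps by (simp add: minor_in_component_prime)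
    ultimately have "?P (?r W) \<subset> ?P (?r (insert i W))" by blast
    then show ?case
      using prime_chain_Suc[OF insert.IH _ primeideal_component_prime] insert by auto
  qed
  have "prime_chain (bei_ring V) (2 * card S + card {i \<in> V - S. r i \<noteq> i})
      (?P (\<lambda>i. if i \<in> {i \<in> V - S. r i \<noteq> i} then r i else i))"
    using fin by (intro merge) auto
  moreover have "?P (\<lambda>i. if i \<in> {i \<in> V - S. r i \<noteq> i} then r i else i) = ?P r"
    unfolding component_prime_def psubst_kernel_def
    by (intro Collect_cong conj_cong refl arg_cong[where f = "\<lambda>p. p = 0"] psubst_cong)
      (auto simp: rank_one_subst_def)
  ultimately show ?thesis by simp
qed

text \<open>Exponents of the images of \<open>X i\<close> and \<open>Y i\<close> under
  \<open>rank_one_subst S r\<close> when \<open>i\<close> lies outside \<open>S\<close> and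
  \<open>r i = i\<close>.\<close>

definition monomial_subst :: "'v bei_var \<Rightarrow> 'v bei_var \<Rightarrow>\<^sub>0 nat" where
  "monomial_subst w = (case w of
     X i \<Rightarrow> Poly_Mapping.single (X i) 1
   | Y i \<Rightarrow> Poly_Mapping.single (X i) 1 + Poly_Mapping.single (Y i) 1)"

text \<open>The substitution \<open>y\<^sub>i \<mapsto> x\<^sub>i y\<^sub>i\<close> sends distinct monomials to distinct monomials.\<close>

lemma psubst_monomial_subst_eq_0D:
  fixes p :: "('v bei_var, 'k::comm_ring_1) mpoly"
  assumes "psubst (\<lambda>w. Poly_Mapping.single (monomial_subst w) 1) p = 0"
  shows "p = 0"
proof -
  define sh where "sh m = (\<Sum>w\<in>Poly_Mapping.keys m. \<Sum>_<Poly_Mapping.lookup m w. monomial_subst w)"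
    for m :: "'v bei_var \<Rightarrow>\<^sub>0 nat"
  have sh: "monom_subst (\<lambda>w. Poly_Mapping.single (monomial_subst w) (1::'k)) m = Poly_Mapping.single (sh m) 1" for m
    by (simp add: monom_subst_def sh_def single_sum_exponents)
  have lookup_sh: "Poly_Mapping.lookup (sh m) z =
      (\<Sum>w\<in>Poly_Mapping.keys m. Poly_Mapping.lookup m w * Poly_Mapping.lookup (monomial_subst w) z)" for m z
    by (simp add: sh_def lookup_sum)
  \<comment> \<open>The exponent of \<open>Y i\<close> is kept and that of \<open>X i\<close> grows
    by it, so \<open>m\<close> can be read off from \<open>sh m\<close>.\<close>
  have shY: "Poly_Mapping.lookup (sh m) (Y i) = Poly_Mapping.lookup m (Y i)" for m i
  proof -
    have "Poly_Mapping.lookup m w * Poly_Mapping.lookup (monomial_subst w) (Y i) =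
        (if w = Y i then Poly_Mapping.lookup m w else 0)" for w
      by (cases w) (auto simp: monomial_subst_def lookup_add lookup_single when_def)
    then show ?thesis unfolding lookup_sh by (simp add: in_keys_iff)
  qed
  have shX: "Poly_Mapping.lookup (sh m) (X i) = Poly_Mapping.lookup m (X i) + Poly_Mapping.lookup m (Y i)" for m i
  proof -
    have "Poly_Mapping.lookup m w * Poly_Mapping.lookup (monomial_subst w) (X i) =
        (if w = X i then Poly_Mapping.lookup m w else 0) + (if w = Y i then Poly_Mapping.lookup m w else 0)" for w
      by (cases w) (auto simp: monomial_subst_def lookup_add lookup_single when_def)
    then show ?thesis unfolding lookup_sh by (simp add: in_keys_iff sum.distrib)
  qed
  have inj: "m = n" if "sh m = sh n" for m n
  proof (rule poly_mapping_eqI)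
    fix w show "Poly_Mapping.lookup m w = Poly_Mapping.lookup n w"
      using shY[of m] shY[of n] shX[of m] shX[of n] that by (cases w) auto
  qed
  have "Poly_Mapping.lookup p n = 0" for n
  proof -
    have "0 = Poly_Mapping.lookup (psubst (\<lambda>w. Poly_Mapping.single (monomial_subst w) 1) p) (sh n)"
      using assms by simp
    also have "\<dots> = (\<Sum>m\<in>Poly_Mapping.keys p. if m = n then Poly_Mapping.lookup p m else 0)"
      unfolding psubst_def lookup_sum sh
      by (intro sum.cong) (auto simp: mult_single lookup_single when_def dest: inj)
    also have "\<dots> = Poly_Mapping.lookup p n" by (simp add: in_keys_iff)
    finally show ?thesis by simp
  qed
  then show ?thesis by (intro poly_mapping_eqI) simp
qed

text \<open>For \<open>W = V - S\<close> these variables are algebraically independent modulo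
  \<open>component_prime V S r\<close>. One \<open>Y\<close> is kept per block, since the columns of
  a block share their direction.\<close>

definition free_vars :: "'v set \<Rightarrow> ('v \<Rightarrow> 'v) \<Rightarrow> 'v bei_var set" where
  "free_vars W r = X ` W \<union> Y ` {i \<in> W. r i = i}"

text \<open>On these variables the rank-one substitution agrees with the injective monomial
  substitution.\<close>

lemma component_prime_free_vars:
  fixes p :: "('v bei_var, 'k::field) mpoly"
  assumes "p \<in> component_prime V S r" "p \<in> polys (free_vars (V - S) r)"
  shows "p = 0"
proof (rule psubst_monomial_subst_eq_0D)
  have "psubst (\<lambda>w. Poly_Mapping.single (monomial_subst w) 1) p = psubst (rank_one_subst S r) p"
    using assms(2)
    by (rule psubst_cong) (auto simp: free_vars_def monomial_subst_def rank_one_subst_def indet_def mult_single)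
  then show "psubst (\<lambda>w. Poly_Mapping.single (monomial_subst w) 1) p = 0"
    using assms(1) by (simp add: component_prime_def psubst_kernel_def)
qed

text \<open>The explicit chain gives the lower bound. The upper bound is the number of variables
  minus the number of free variables, by \<open>prime_chain_le\<close>.\<close>

lemma height_component_prime:
  fixes V :: "'v set"
  assumes fin: "finite V" and S: "S \<subseteq> V"
    and idem: "\<And>i. i \<in> V - S \<Longrightarrow> r (r i) = r i" and rV: "\<And>i. i \<in> V - S \<Longrightarrow> r i \<in> V - S"
  shows "height (bei_ring V) (component_prime V S r :: ('v bei_var, 'k::field) mpoly set) =
    enat (2 * card S + card {i \<in> V - S. r i \<noteq> i})"
proof (rule height_eqI)
  show "prime_chain (bei_ring V) (2 * card S + card {i \<in> V - S. r i \<noteq> i})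
    (component_prime V S r :: ('v bei_var, 'k) mpoly set)"
    using assms by (rule prime_chain_component_prime)
next
  fix k assume k: "prime_chain (bei_ring V) k (component_prime V S r :: ('v bei_var, 'k) mpoly set)"
  let ?B = "free_vars (V - S) r"
  have "k + card ?B \<le> card (bei_vars V)"
  proof (rule prime_chain_le[OF _ _ _ k[unfolded bei_ring_def]])
    show "component_prime V S r \<inter> polys ?B \<subseteq> {0 :: ('v bei_var, 'k) mpoly}"
      using component_prime_free_vars by blast
  qed (use fin in \<open>auto simp: free_vars_def\<close>)
  moreover have "card (bei_vars V) = 2 * card V"
    using fin by (subst card_Un_disjoint) (auto simp: card_image inj_on_def)
  moreover have "card ?B = card (V - S) + card {i \<in> V - S. r i = i}"
    unfolding free_vars_def using fin
    by (subst card_Un_disjoint) (auto simp: card_image inj_on_def)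
  moreover have "card (V - S) = card {i \<in> V - S. r i = i} + card {i \<in> V - S. r i \<noteq> i}"
    using fin by (subst card_Un_disjoint[symmetric]) (auto intro: arg_cong[where f = card])
  moreover have "card V = card (V - S) + card S"
    using fin S finite_subset[OF S fin] card_Un_disjoint[of "V - S" S]
    by (simp add: Int_commute Un_absorb2)
  ultimately show "k \<le> 2 * card S + card {i \<in> V - S. r i \<noteq> i}" by linarith
qed

section \<open>Minimality of the primes of cut sets, and unmixedness\<close>

lemma edge_ideal_subset_iff:
  fixes P :: "('v bei_var, 'k::field) mpoly set"
  assumes G: "finite_simple_graph V E" and P: "primeideal P (bei_ring V)"
  shows "binomial_edge_ideal V E \<subseteq> P \<longleftrightarrow> (\<forall>i j. {i, j} \<in> E \<longrightarrow> minor i j \<in> P)"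
proof -
  interpret cring "bei_ring V :: ('v bei_var, 'k) mpoly ring"
    unfolding bei_ring_def by (rule cring_poly_ring)
  have EV: "i \<in> V \<and> j \<in> V" if "{i, j} \<in> E" for i j
    using G that by (fastforce simp: finite_simple_graph_def doubleton_eq_iff)
  let ?G = "{minor i j | i j. {i, j} \<in> E} :: ('v bei_var, 'k) mpoly set"
  have "?G \<subseteq> carrier (bei_ring V)"
  proof
    fix p assume "p \<in> ?G"
    then obtain i j where "p = minor i j" "{i, j} \<in> E" by blast
    then show "p \<in> carrier (bei_ring V)"
      using EV[of i j] minor_in_polys[of i V j] unfolding bei_ring_def by blast
  qed
  then have "?G \<subseteq> binomial_edge_ideal V E"
    unfolding binomial_edge_ideal_def by (rule genideal_self)
  moreover have "binomial_edge_ideal V E \<subseteq> P" if "?G \<subseteq> P"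
    unfolding binomial_edge_ideal_def
    using primeideal.axioms(1)[OF P] that by (rule genideal_minimal)
  ultimately show ?thesis by blast
qed

text \<open>The choice is made from the component as a set, so connected vertices receive the same
  representative.\<close>

definition comp_rep :: "'v set set \<Rightarrow> 'v set \<Rightarrow> 'v \<Rightarrow> 'v" where
  "comp_rep E W i = (SOME j. j \<in> comp_of E W i)"

lemma comp_rep_conn: "conn E W i (comp_rep E W i)"
  using someI[of "\<lambda>j. j \<in> comp_of E W i" i] by (simp add: comp_rep_def)

lemma comp_rep_eq_iff: "comp_rep E W i = comp_rep E W j \<longleftrightarrow> conn E W i j"
proof
  assume "comp_rep E W i = comp_rep E W j"
  then show "conn E W i j"
    using comp_rep_conn[of i E W] conn_sym[OF comp_rep_conn[of j E W]] by (metis rtrancl_trans)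
next
  assume "conn E W i j"
  then show "comp_rep E W i = comp_rep E W j"
    unfolding comp_of_eq_iff[symmetric] comp_rep_def by simp
qed

lemma comp_rep_idem: "comp_rep E W (comp_rep E W i) = comp_rep E W i"
  unfolding comp_rep_eq_iff by (rule conn_sym[OF comp_rep_conn])

lemma comp_rep_in: "i \<in> W \<Longrightarrow> comp_rep E W i \<in> W"
  using conn_in[OF comp_rep_conn] .

text \<open>Each component contains exactly one vertex representing itself. This turns the height
  formula into one about the number of components.\<close>

lemma ncomp_eq_card_fixed_reps:
  "ncomp E W = card {i \<in> W. comp_rep E W i = i}"
proof -
  have "bij_betw (comp_of E W) {i \<in> W. comp_rep E W i = i} (components E W)"
  proof (rule bij_betw_imageI)
    show "inj_on (comp_of E W) {i \<in> W. comp_rep E W i = i}"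
      by (rule inj_onI) (simp add: comp_of_eq_iff comp_rep_eq_iff[symmetric])
    show "comp_of E W ` {i \<in> W. comp_rep E W i = i} = components E W"
    proof (intro equalityI subsetI)
      fix K assume "K \<in> components E W"
      then obtain i where i: "i \<in> W" "K = comp_of E W i" by (auto simp: components_eq)
      then have "K = comp_of E W (comp_rep E W i)" using comp_rep_conn[of i E W] by (simp only: comp_of_eq_iff)
      then show "K \<in> comp_of E W ` {i \<in> W. comp_rep E W i = i}"
        using i comp_rep_in comp_rep_idem by (metis (mono_tags, lifting) image_eqI mem_Collect_eq)
    qed (auto simp: components_eq)
  qed
  then show ?thesis by (rule bij_betw_same_card[symmetric])
qed

text \<open>
  Modulo a prime containing the minors within the blocks, every polynomial becomes, after
  multiplication by suitable \<open>x\<^sub>r\<close>, a polynomial in the free variables, because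
  \<open>x\<^sub>r y\<^sub>i \<equiv> x\<^sub>i y\<^sub>r\<close> for the representative \<open>r\<close> of \<open>i\<close>.
\<close>

lemma component_prime_subset:
  fixes Q :: "('v bei_var, 'k::field) mpoly set"
  assumes Q: "primeideal Q (bei_ring V)" and QP: "Q \<subseteq> component_prime V S r"
    and idem: "\<And>i. i \<in> V - S \<Longrightarrow> r (r i) = r i" and rV: "\<And>i. i \<in> V - S \<Longrightarrow> r i \<in> V - S"
    and SQ: "\<And>s. s \<in> S \<inter> V \<Longrightarrow> indet (X s) \<in> Q \<and> indet (Y s) \<in> Q"
    and minors: "\<And>i. i \<in> V - S \<Longrightarrow> minor i (r i) \<in> Q"
  shows "component_prime V S r \<subseteq> Q"
proof
  note Q' = Q[unfolded bei_ring_def]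
  let ?I = "bei_vars V" and ?B = "free_vars (V - S) r"
  have BI: "?B \<subseteq> ?I" by (auto simp: free_vars_def)
  have BQ: "p \<notin> Q" if "p \<in> polys ?B" "p \<noteq> 0" for p
    using component_prime_free_vars that QP by blast
  \<comment> \<open>\<open>M\<close> acts as a common denominator; by \<open>BQ\<close> it lies
    outside \<open>Q\<close> and can be cancelled at the end.\<close>
  have red: "\<exists>M p'. M \<in> polys ?B \<and> M \<noteq> 0 \<and> p' \<in> polys ?B \<and> M * p - p' \<in> Q"
    if "p \<in> polys ?I" for p
    using that
  proof (induction p rule: polys_induct)
    case (const c)
    show ?case
      by (rule exI[of _ 1], rule exI[of _ "const c"]) (simp add: primeideal_0[OF Q'])
  next
    case (indet w)
    then obtain i where i: "i \<in> V" "w = X i \<or> w = Y i" by blast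
    show ?case
    proof (cases "i \<in> S")
      case True
      then have "indet w \<in> Q" using SQ i by auto
      then show ?thesis by (intro exI[of _ 1] exI[of _ 0]) simp
    next
      case False
      then have iW: "i \<in> V - S" using i by simp
      show ?thesis
      proof (cases "w = X i")
        case True
        then have "indet w \<in> polys ?B" using iW by (intro polys_indet) (auto simp: free_vars_def)
        then show ?thesis
          by (intro exI[of _ 1] exI[of _ "indet w"]) (simp add: primeideal_0[OF Q'])
      next
        case False
        then have w: "w = Y i" using i by simp
        have B: "indet (X (r i)) \<in> polys ?B" "indet (X i) * indet (Y (r i)) \<in> polys ?B"
          using iW rV[OF iW] idem[OF iW] by (auto simp: free_vars_def intro!: polys_mult polys_indet)
        have "0 - minor i (r i) \<in> Q"
          using primeideal_diff[OF Q' primeideal_0[OF Q'] minors[OF iW]] .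
        then have "indet (X (r i)) * indet w - indet (X i) * indet (Y (r i)) \<in> Q" by (simp add: w)
        then show ?thesis using B
          by (intro exI[of _ "indet (X (r i))"] exI[of _ "indet (X i) * indet (Y (r i))"]) simp
      qed
    qed
  next
    case (add p q)
    then obtain M p' N q' where M: "M \<in> polys ?B" "M \<noteq> 0" "p' \<in> polys ?B" "M * p - p' \<in> Q"
      and N: "N \<in> polys ?B" "N \<noteq> 0" "q' \<in> polys ?B" "N * q - q' \<in> Q" by blast
    have MN: "M \<in> polys ?I" "N \<in> polys ?I" using M N polys_mono[OF BI] by blast+
    have "N * (M * p - p') + M * (N * q - q') \<in> Q"
      using M N MN by (intro primeideal_add[OF Q'] primeideal_mult[OF Q']) auto
    also have "N * (M * p - p') + M * (N * q - q') = (M * N) * (p + q) - (N * p' + M * q')"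
      by (simp add: algebra_simps)
    finally show ?case using M N by (intro exI[of _ "M * N"] exI[of _ "N * p' + M * q'"]) auto
  next
    case (mult p q)
    then obtain M p' N q' where M: "M \<in> polys ?B" "M \<noteq> 0" "p' \<in> polys ?B" "M * p - p' \<in> Q"
      and N: "N \<in> polys ?B" "N \<noteq> 0" "q' \<in> polys ?B" "N * q - q' \<in> Q" by blast
    have MN: "M \<in> polys ?I" "q' \<in> polys ?I" using M N polys_mono[OF BI] by blast+
    have "(M * p) * (N * q - q') + q' * (M * p - p') \<in> Q"
      using M N MN mult.hyps by (intro primeideal_add[OF Q'] primeideal_mult[OF Q']) auto
    also have "(M * p) * (N * q - q') + q' * (M * p - p') = (M * N) * (p * q) - p' * q'"
      by (simp add: algebra_simps)
    finally show ?case using M N by (intro exI[of _ "M * N"] exI[of _ "p' * q'"]) auto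
  qed
  fix p :: "('v bei_var, 'k) mpoly" assume p: "p \<in> component_prime V S r"
  have P': "primeideal (component_prime V S r :: ('v bei_var, 'k) mpoly set) (poly_ring ?I)"
    using primeideal_component_prime unfolding bei_ring_def .
  have pI: "p \<in> polys ?I" using primeideal_subset[OF P' p] .
  then obtain M p' where M: "M \<in> polys ?B" "M \<noteq> 0" "p' \<in> polys ?B" "M * p - p' \<in> Q"
    using red by blast
  have MI: "M \<in> polys ?I" using M polys_mono[OF BI] by blast
  \<comment> \<open>For \<open>p\<close> in the component prime, \<open>p'\<close> lies there too
    and involves free variables alone, so it vanishes and \<open>M * p\<close> lies in
    \<open>Q\<close>.\<close>
  have "M * p - (M * p - p') \<in> component_prime V S r"
    using primeideal_diff[OF P' primeideal_mult[OF P' MI p]] M(4) QP by blast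
  then have "p' = 0" using component_prime_free_vars M by simp
  then show "p \<in> Q" using primeideal_prime[OF Q' MI pI] BQ M by auto
qed

lemma cut_set_neighbours:
  assumes "finite V" "S \<in> cut_sets V E" "s \<in> S"
  obtains a b where "a \<in> V - S" "b \<in> V - S" "{s, a} \<in> E" "{s, b} \<in> E" "\<not> conn E (V - S) a b"
proof -
  have "V - (S - {s}) = insert s (V - S)" using assms by (auto simp: cut_sets_def)
  then have "ncomp E (insert s (V - S)) < ncomp E (V - S)"
    using assms(2,3) by (fastforce simp: cut_sets_def c_comp_def)
  then show thesis
    using assms by (elim ncomp_insert_lessD[rotated 2]) (auto intro: that)
qed

text \<open>Let \<open>Q\<close> be a prime between the edge ideal and \<open>?P\<close>. Along
  paths outside \<open>S\<close> the factors \<open>X j\<close>, absent from \<open>Q\<close>,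
  cancel, so the minors within components lie in \<open>Q\<close>. A vertex \<open>s\<close> of
  \<open>S\<close> has neighbours in two different components; their minor is not in
  \<open>Q\<close>, which forces both variables of \<open>s\<close> into \<open>Q\<close>.\<close>

lemma component_prime_minimal:
  fixes V :: "'v set" and E :: "'v set set"
  assumes G: "finite_simple_graph V E" and S: "S \<in> cut_sets V E"
  shows "component_prime V S (comp_rep E (V - S)) \<in>
    minimal_primes (bei_ring V :: ('v bei_var, 'k::field) mpoly ring) (binomial_edge_ideal V E)"
proof -
  let ?r = "comp_rep E (V - S)"
  let ?P = "component_prime V S ?r :: ('v bei_var, 'k) mpoly set"
  have fin: "finite V" and SV: "S \<subseteq> V" using G S by (auto simp: finite_simple_graph_def cut_sets_def)
  have EV: "i \<in> V \<and> j \<in> V" if "{i, j} \<in> E" for i j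
    using G that by (fastforce simp: finite_simple_graph_def doubleton_eq_iff)
  have XP: "indet (X i) \<in> ?P \<longleftrightarrow> i \<in> S" if "i \<in> V" for i
    using that by (cases "i \<in> S") (simp_all add: component_prime_def psubst_kernel_def)
  show ?thesis
    unfolding minimal_primes_def
  proof (intro CollectI conjI allI impI)
    show "primeideal ?P (bei_ring V)" by (rule primeideal_component_prime)
    have "minor i j \<in> ?P" if e: "{i, j} \<in> E" for i j
    proof (cases "i \<in> S \<or> j \<in> S")
      case True
      then show ?thesis
        using EV[OF e] by (auto simp: component_prime_def psubst_kernel_def rank_one_subst_def)
    next
      case False
      then have "conn E (V - S) i j" using EV[OF e] e by (intro conn_edge) auto
      then show ?thesis using EV[OF e] False by (simp add: minor_in_component_prime comp_rep_eq_iff)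
    qed
    then show "binomial_edge_ideal V E \<subseteq> ?P"
      using edge_ideal_subset_iff[OF G primeideal_component_prime] by blast
  next
    fix Q :: "('v bei_var, 'k) mpoly set"
    assume Q: "primeideal Q (bei_ring V) \<and> binomial_edge_ideal V E \<subseteq> Q \<and> Q \<subseteq> ?P"
    then have Q': "primeideal Q (poly_ring (bei_vars V))" by (simp add: bei_ring_def)
    have edge: "minor i j \<in> Q" if "{i, j} \<in> E" for i j
      using that edge_ideal_subset_iff[OF G] Q by blast
    have var: "indet (X i) \<in> polys (bei_vars V)" "indet (Y i) \<in> polys (bei_vars V)" if "i \<in> V" for i
      using that by (auto intro: polys_indet)
    \<comment> \<open>The identities here and in \<open>trans_Y\<close> expand a vanishing 3-by-3
      determinant whose rows are both rows of variables with one of them repeated.\<close>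
    have trans_X: "indet (X j) * minor i k \<in> Q"
      if "minor i j \<in> Q" "minor j k \<in> Q" "i \<in> V" "k \<in> V" for i j k
    proof -
      have "indet (X i) * minor j k + indet (X k) * minor i j \<in> Q"
        using that var by (intro primeideal_add[OF Q'] primeideal_mult[OF Q']) auto
      also have "indet (X i) * minor j k + indet (X k) * minor i j = indet (X j) * minor i k"
        by (simp add: algebra_simps)
      finally show ?thesis .
    qed
    have trans_Y: "indet (Y j) * minor i k \<in> Q"
      if "minor i j \<in> Q" "minor j k \<in> Q" "i \<in> V" "k \<in> V" for i j k
    proof -
      have "indet (Y k) * minor i j + indet (Y i) * minor j k \<in> Q"
        using that var by (intro primeideal_add[OF Q'] primeideal_mult[OF Q']) auto
      also have "indet (Y k) * minor i j + indet (Y i) * minor j k = indet (Y j) * minor i k"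
        by (simp add: algebra_simps)
      finally show ?thesis .
    qed
    have XQ: "indet (X i) \<notin> Q" if "i \<in> V - S" for i using XP[of i] that Q by blast
    have conn: "minor i j \<in> Q" if "conn E (V - S) i j" "i \<in> V - S" for i j
      using that
    proof (induction rule: rtrancl_induct)
      case base
      then show ?case using primeideal_0[OF Q'] by simp
    next
      case (step j k)
      then have jk: "j \<in> V - S" "k \<in> V - S" "{j, k} \<in> E" by (auto simp: induced_adj_def)
      then have "indet (X j) * minor i k \<in> Q" using trans_X[of i j k] step edge by auto
      then show ?case using primeideal_prime[OF Q' var(1), of j "minor i k"] jk XQ step by auto
    qed
    have "?P \<subseteq> Q"
    proof (rule component_prime_subset)
      show "primeideal Q (bei_ring V)" "Q \<subseteq> ?P" using Q by auto
      show "?r (?r i) = ?r i" for i by (rule comp_rep_idem)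
      show "?r i \<in> V - S" if "i \<in> V - S" for i using that by (rule comp_rep_in)
      show "minor i (?r i) \<in> Q" if "i \<in> V - S" for i using conn[OF comp_rep_conn that] .
      fix s assume "s \<in> S \<inter> V"
      then obtain a b where ab: "a \<in> V - S" "b \<in> V - S" "{s, a} \<in> E" "{s, b} \<in> E"
        "\<not> conn E (V - S) a b"
        using cut_set_neighbours[OF fin S] by blast
      then have as: "minor a s \<in> Q" "minor s b \<in> Q"
        using edge by (auto simp: insert_commute)
      have "minor a b \<notin> ?P" using ab by (simp add: minor_in_component_prime comp_rep_eq_iff)
      then have "minor a b \<notin> Q" using Q by blast
      then show "indet (X s) \<in> Q \<and> indet (Y s) \<in> Q"
        using trans_X[OF as] trans_Y[OF as] ab \<open>s \<in> S \<inter> V\<close> var[of s]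
          primeideal_prime[OF Q' var(1)[of s], of "minor a b"]
          primeideal_prime[OF Q' var(2)[of s], of "minor a b"] by auto
    qed
    then show "Q = ?P" using Q by blast
  qed
qed

text \<open>The empty set is a cut set, so unmixedness equates the height belonging to
  \<open>S\<close> with the one belonging to \<open>{}\<close>.\<close>

lemma unmixed_c_comp:
  fixes V :: "'v set" and E :: "'v set set"
  assumes G: "finite_simple_graph V E"
    and un: "unmixed (bei_ring V :: ('v bei_var, 'k::field) mpoly ring) (binomial_edge_ideal V E)"
    and S: "S \<in> cut_sets V E"
  shows "c_comp V E S = card S + c_comp V E {}"
proof -
  have fin: "finite V" using G by (simp add: finite_simple_graph_def)
  \<comment> \<open>The additive form avoids subtraction in \<open>enat\<close> and shows that the
    height is finite, so that it can be cancelled below.\<close>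
  have h: "height (bei_ring V) (component_prime V U (comp_rep E (V - U)) :: ('v bei_var, 'k) mpoly set) + enat (c_comp V E U)
      = enat (card V + card U)" if "U \<in> cut_sets V E" for U
  proof -
    let ?r = "comp_rep E (V - U)"
    have UV: "U \<subseteq> V" using that by (auto simp: cut_sets_def)
    have "card (V - U) = card {i \<in> V - U. ?r i = i} + card {i \<in> V - U. ?r i \<noteq> i}"
      using fin by (subst card_Un_disjoint[symmetric]) (auto intro: arg_cong[where f = card])
    moreover have "card V = card (V - U) + card U"
      using fin UV finite_subset[OF UV fin] card_Un_disjoint[of "V - U" U]
      by (simp add: Int_commute Un_absorb2)
    moreover have "height (bei_ring V) (component_prime V U ?r :: ('v bei_var, 'k) mpoly set) =
        enat (2 * card U + card {i \<in> V - U. ?r i \<noteq> i})"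
      using fin UV comp_rep_idem comp_rep_in by (rule height_component_prime)
    ultimately show ?thesis by (simp add: c_comp_def ncomp_eq_card_fixed_reps)
  qed
  have e: "{} \<in> cut_sets V E" by (simp add: cut_sets_def)
  have "height (bei_ring V) (component_prime V S (comp_rep E (V - S)) :: ('v bei_var, 'k) mpoly set) =
      height (bei_ring V) (component_prime V {} (comp_rep E (V - {})) :: ('v bei_var, 'k) mpoly set)"
    using un component_prime_minimal[OF G S] component_prime_minimal[OF G e]
    unfolding unmixed_def by blast
  then show ?thesis
    using h[OF S] h[OF e]
    by (cases "height (bei_ring V) (component_prime V {} (comp_rep E (V - {})) :: ('v bei_var, 'k) mpoly set)") auto
qed

theorem theorem3p9:
  fixes V :: "'v set" and E :: "'v set set"
  assumes "finite_simple_graph V E"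
    and "unmixed (bei_ring V :: ('v bei_var, 'k::field) mpoly ring) (binomial_edge_ideal V E)"
  shows "accessible (cut_sets V E) \<longleftrightarrow> strongly_accessible (cut_sets V E)"
  using accessible_iff_strongly_accessible_cut_sets[of V E] unmixed_c_comp[OF assms] assms(1)
  by (simp add: finite_simple_graph_def)

end
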